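(* Let $p\in(0,1)$ be fixed and let $G_n(p)$ be the Erdős–Rényi random graph on $\{1,\dots,n\}$ (each edge present independently with probability $p$). Then for almost every $G_n(p)$, $\mathcal{E}(G_n(p))<\mathcal{LE}(G_n(p))$; that is, $\Pr\big(\mathcal{E}(G_n(p))<\mathcal{LE}(G_n(p))\big)\to1$ as $n\to\infty$.
   Context: For a simple graph $G$ on vertices $v_1,\dots,v_n$ with adjacency matrix $\mathbf{A}(G)$, the energy is $\mathcal{E}(G)=\sum_i|\lambda_i|$ over the eigenvalues $\lambda_i$ of $\mathbf{A}(G)$. With $\mathbf{D}(G)$ the diagonal degree matrix and $\mathbf{L}(G)=\mathbf{D}(G)-\mathbf{A}(G)$, set $\mathcal{L}(G)=\mathbf{L}(G)-\frac1n\sum_{i=1}^n d_G(v_i)\,\mathbf{I}_n$; the Laplacian energy is $\mathcal{LE}(G)=\sum_i|\zeta_i|$ over the eigenvalues $\zeta_i$ of $\mathcal{L}(G)$. *)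

theory Defs
  imports "HOL-Probability.Probability" "Jordan_Normal_Form.Char_Poly"
begin

hide_const (open) Finite_Cartesian_Product.mat

text \<open>
  A simple graph on the vertex set \<open>{1..n}\<close> is represented by its edge set, a subset of \<open>all_edges n\<close>.
  Matrix indices start at \<open>0\<close>, so row and column \<open>i\<close> belong to the vertex \<open>Suc i\<close>.
\<close>

definition all_edges :: "nat \<Rightarrow> nat set set" where
  "all_edges n = {e. e \<subseteq> {1..n} \<and> card e = 2}"

definition degree_in :: "nat \<Rightarrow> nat set set \<Rightarrow> nat \<Rightarrow> nat" where
  "degree_in n E v = card {u \<in> {1..n}. {u, v} \<in> E}"

definition adjacency_matrix :: "nat \<Rightarrow> nat set set \<Rightarrow> real mat" where
  "adjacency_matrix n E = mat n n (\<lambda>(i, j). if {Suc i, Suc j} \<in> E then 1 else 0)"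

definition degree_matrix :: "nat \<Rightarrow> nat set set \<Rightarrow> real mat" where
  "degree_matrix n E = mat n n (\<lambda>(i, j). if i = j then real (degree_in n E (Suc i)) else 0)"

definition laplacian_matrix :: "nat \<Rightarrow> nat set set \<Rightarrow> real mat" where
  "laplacian_matrix n E = degree_matrix n E - adjacency_matrix n E"

definition centred_laplacian_matrix :: "nat \<Rightarrow> nat set set \<Rightarrow> real mat" where
  "centred_laplacian_matrix n E =
     laplacian_matrix n E - ((1 / real n) * (\<Sum>v = 1..n. real (degree_in n E v))) \<cdot>\<^sub>m 1\<^sub>m n"

text \<open>
  Eigenvalues are counted with algebraic multiplicity. They are taken in the complex numbers, where
  the characteristic polynomial splits; for the symmetric matrices used here they are all real, so
  \<open>cmod\<close> is the absolute value.
\<close>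

definition eigenvalue_mset :: "real mat \<Rightarrow> complex multiset" where
  "eigenvalue_mset M = proots (char_poly (map_mat complex_of_real M))"

lemma size_eigenvalue_mset:
  assumes "M \<in> carrier_mat n n"
  shows "size (eigenvalue_mset M) = n"
proof -
  have M: "map_mat complex_of_real M \<in> carrier_mat n n" using assms by simp
  show ?thesis
    unfolding eigenvalue_mset_def size_proots_complex
    using degree_monic_char_poly[OF M] by blast
qed

lemma set_eigenvalue_mset:
  assumes "M \<in> carrier_mat n n"
  shows "set_mset (eigenvalue_mset M) = {z. eigenvalue (map_mat complex_of_real M) z}"
proof -
  let ?M = "map_mat complex_of_real M"
  have M: "?M \<in> carrier_mat n n" using assms by simp
  have "coeff (char_poly ?M) n = 1"
    using degree_monic_char_poly[OF M] by blast
  then have "char_poly ?M \<noteq> 0"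
    by (metis coeff_0 zero_neq_one)
  then show ?thesis
    unfolding eigenvalue_mset_def eigenvalue_root_char_poly[OF M] by (rule set_count_proots)
qed

definition graph_energy :: "nat \<Rightarrow> nat set set \<Rightarrow> real" where
  "graph_energy n E = (\<Sum>z\<in>#eigenvalue_mset (adjacency_matrix n E). cmod z)"

definition laplacian_energy :: "nat \<Rightarrow> nat set set \<Rightarrow> real" where
  "laplacian_energy n E = (\<Sum>z\<in>#eigenvalue_mset (centred_laplacian_matrix n E). cmod z)"

definition erdos_renyi :: "nat \<Rightarrow> real \<Rightarrow> nat set set pmf" where
  "erdos_renyi n p =
     map_pmf (\<lambda>X. {e \<in> all_edges n. X e}) (Pi_pmf (all_edges n) False (\<lambda>_. bernoulli_pmf p))"

end

theory Submission
  imports Defs "Jordan_Normal_Form.Spectral_Radius" "HOL-Real_Asymp.Real_Asymp"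
begin

text \<open>
  Both energies are trace norms. Centre the adjacency matrix to \<open>adj\<close>, whose off-diagonal entries have
  mean \<open>0\<close> and variance \<open>\<sigma>\<^sup>2 = p * (1 - p)\<close>, and let \<open>lap\<close> be the diagonal matrix of its row sums minus
  \<open>adj\<close>. By trace-norm duality, replacing the two matrices by \<open>adj\<close> and \<open>lap\<close> costs only \<open>O(n)\<close> plus the
  absolute value of the total row sum, and every quantity changes by \<open>O(1)\<close> when one edge is flipped. So
  the difference of the energies has variance \<open>O(n\<^sup>2)\<close>, and it is enough to show that its mean is
  at least a positive multiple of \<open>n\<close> to the power \<open>3/2\<close>.

  For that no limit law is needed, only a few moments. In units of \<open>\<sigma> * sqrt n\<close> the normalised traces of
  \<open>lap\<^sup>2\<close> and \<open>lap\<^sup>4\<close> tend to 2 and 9, and \<open>\<bar>x\<bar> \<ge> 3/4 * x^2 - x^4 / 16\<close> bounds the mean trace norm of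
  \<open>lap\<close> from below by \<open>15/16\<close>. Those of \<open>adj\<^sup>2\<close>, \<open>adj\<^sup>4\<close>, \<open>adj\<^sup>6\<close> tend to 1, 2, 5, and
  \<open>22 * \<bar>x\<bar> \<le> x^6 - 7 * x^4 + 23 * x^2 + 6\<close> bounds the mean trace norm of \<open>adj\<close> from above by
  \<open>20/22 < 15/16\<close>.
\<close>

unbundle no inner_syntax and no vec_syntax

subsection \<open>Orthogonal diagonalization of real symmetric matrices\<close>

text \<open>A complex eigenvector always exists. Symmetry makes the Hermitian form at it real, hence
  the eigenvalue real, and then its real or its imaginary part is a nonzero real eigenvector, which
  is normalised.\<close>

lemma symmetric_mat_real_eigenvector:
  fixes A :: "real mat"
  assumes A: "A \<in> carrier_mat n n" and sym: "A\<^sup>T = A" and n: "n > 0"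
  obtains v l where "v \<in> carrier_vec n" "v \<bullet> v = 1" "A *\<^sub>v v = l \<cdot>\<^sub>v v"
proof -
  let ?C = "map_mat complex_of_real A"
  have C: "?C \<in> carrier_mat n n" using A by simp
  have sA: "A $$ (i,j) = A $$ (j,i)" if "i < n" "j < n" for i j
    using A that by (metis carrier_matD index_transpose_mat(1) sym)
  obtain k where "eigenvalue ?C k"
    using spectrum_non_empty[OF C] n unfolding spectrum_def by auto
  then obtain z where z: "z \<in> carrier_vec n" "z \<noteq> 0\<^sub>v n" "?C *\<^sub>v z = k \<cdot>\<^sub>v z"
    using A by (auto simp: eigenvalue_def eigenvector_def)
  have row: "(\<Sum>j<n. of_real (A $$ (i,j)) * z $ j) = k * z $ i" if "i < n" for i
  proof -
    have "(?C *\<^sub>v z) $ i = (\<Sum>j<n. of_real (A $$ (i,j)) * z $ j)"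
      using A z(1) that by (simp add: scalar_prod_def atLeast0LessThan)
    then show ?thesis unfolding z(3) using z(1) that by simp
  qed
  define N where "N = (\<Sum>i<n. (cmod (z $ i))\<^sup>2)"
  have N: "N > 0"
  proof -
    obtain i where "i < n" "z $ i \<noteq> 0" using z by (metis carrier_vecD eq_vecI index_zero_vec)
    then show ?thesis unfolding N_def by (intro sum_pos2[of _ i]) auto
  qed
  have q: "k * of_real N = (\<Sum>i<n. \<Sum>j<n. of_real (A $$ (i,j)) * z $ j * cnj (z $ i))"
  proof -
    have "k * of_real N = (\<Sum>i<n. (k * z $ i) * cnj (z $ i))"
      by (simp add: N_def sum_distrib_left mult.assoc flip: complex_norm_square)
    then show ?thesis by (simp add: row[symmetric] sum_distrib_right)
  qed
  \<comment> \<open>Conjugation fixes the entries of \<open>A\<close> and exchanges the roles of the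
    two indices, which the symmetry of \<open>A\<close> undoes.\<close>
  have "cnj k * of_real N = k * of_real N"
  proof -
    have "cnj (k * of_real N) = (\<Sum>i<n. \<Sum>j<n. of_real (A $$ (i,j)) * cnj (z $ j) * z $ i)"
      by (simp add: q)
    also have "\<dots> = (\<Sum>j<n. \<Sum>i<n. of_real (A $$ (i,j)) * cnj (z $ j) * z $ i)"
      by (rule sum.swap)
    also have "\<dots> = k * of_real N"
      unfolding q by (intro sum.cong refl) (simp add: sA mult_ac)
    finally show ?thesis by simp
  qed
  then have "cnj k = k" using N by simp
  then have k: "k = of_real (Re k)" by (simp add: complex_eq_iff)
  \<comment> \<open>As \<open>k\<close> is real, \<open>Re\<close> and \<open>Im\<close> both
    preserve the eigenvalue equation; \<open>f\<close> is one that does not annihilate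
    \<open>z\<close>.\<close>
  obtain f :: "complex \<Rightarrow> real" where f: "f = Re \<or> f = Im" and fz: "\<exists>i<n. f (z $ i) \<noteq> 0"
  proof -
    obtain i where i: "i < n" "z $ i \<noteq> 0" using z by (metis carrier_vecD eq_vecI index_zero_vec)
    then have "Re (z $ i) \<noteq> 0 \<or> Im (z $ i) \<noteq> 0" by (simp add: complex_eq_iff)
    then show ?thesis using that[of Re] that[of Im] i by blast
  qed
  have f_lin: "f (of_real r * x) = r * f x" "f (sum g S) = (\<Sum>s\<in>S. f (g s))"
    for r x and g :: "nat \<Rightarrow> complex" and S
    using f by auto
  have rowf: "(\<Sum>j<n. A $$ (i,j) * f (z $ j)) = Re k * f (z $ i)" if "i < n" for i
    using arg_cong[OF row[OF that], of f] k by (metis (no_types, lifting) f_lin sum.cong)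
  define s where "s = sqrt (\<Sum>i<n. (f (z $ i))\<^sup>2)"
  obtain i0 where "i0 < n" "f (z $ i0) \<noteq> 0" using fz by blast
  then have "(\<Sum>i<n. (f (z $ i))\<^sup>2) > 0" by (intro sum_pos2[of _ i0]) auto
  then have s: "s > 0" "s\<^sup>2 = (\<Sum>i<n. (f (z $ i))\<^sup>2)" by (auto simp: s_def)
  let ?v = "vec n (\<lambda>i. f (z $ i) / s)"
  have "?v \<bullet> ?v = 1"
    using s(1) by (simp add: scalar_prod_def atLeast0LessThan flip: power2_eq_square)
      (simp add: power_divide s(2)[symmetric] flip: sum_divide_distrib)
  moreover have "A *\<^sub>v ?v = Re k \<cdot>\<^sub>v ?v"
    using A rowf by (intro eq_vecI) (auto simp: scalar_prod_def atLeast0LessThan simp flip: sum_divide_distrib)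
  ultimately show ?thesis by (intro that[of ?v "Re k"]) auto
qed

text \<open>The Householder reflection that maps the first unit vector to \<open>v\<close>. If \<open>v\<close> is that unit vector
  itself, then \<open>c = 1 / 0 = 0\<close> gives the identity.\<close>

lemma reflection_with_first_column:
  fixes v :: "real vec"
  assumes v: "v \<in> carrier_vec (Suc n)" "v \<bullet> v = 1"
  obtains W where "W \<in> carrier_mat (Suc n) (Suc n)" "W\<^sup>T = W" "W * W = 1\<^sub>m (Suc n)"
    "W *\<^sub>v unit_vec (Suc n) 0 = v"
proof -
  define w where "w i = of_bool (i = 0) - v $ i" for i
  define c where "c = 1 / (1 - v $ 0)"
  define W where "W = mat (Suc n) (Suc n) (\<lambda>(i,j). of_bool (i = j) - c * w i * w j)"
  have vv: "(\<Sum>i<Suc n. v $ i * v $ i) = 1" using v by (simp add: scalar_prod_def atLeast0LessThan)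
  have "(\<Sum>i<Suc n. w i * w i) = (\<Sum>i<Suc n. v $ i * v $ i + of_bool (i = 0) * (1 - 2 * v $ 0))"
    by (intro sum.cong refl) (auto simp: w_def algebra_simps)
  also have "\<dots> = 2 * (1 - v $ 0)"
    unfolding sum.distrib vv sum_distrib_right[symmetric] by simp
  finally have ww: "(\<Sum>i<Suc n. w i * w i) = 2 * (1 - v $ 0)" .
  \<comment> \<open>This identity is what makes the rank-one corrections cancel in
    \<open>W * W\<close>.\<close>
  have cc: "c * c * (\<Sum>i<Suc n. w i * w i) = 2 * c"
    unfolding ww c_def by (cases "1 - v $ 0 = 0") (simp_all only: div_by_0, simp_all add: divide_simps)
  have W: "W \<in> carrier_mat (Suc n) (Suc n)" by (simp add: W_def)
  have "W\<^sup>T = W" by (rule eq_matI) (auto simp: W_def mult_ac)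
  moreover have "W * W = 1\<^sub>m (Suc n)"
  proof (rule eq_matI)
    fix i j assume "i < dim_row (1\<^sub>m (Suc n))" "j < dim_col (1\<^sub>m (Suc n))"
    then have ij: "i < Suc n" "j < Suc n" by auto
    have "(W * W) $$ (i,j) = (\<Sum>k<Suc n. (of_bool (i = k) - c * w i * w k) * (of_bool (k = j) - c * w k * w j))"
      using ij by (simp add: W_def scalar_prod_def atLeast0LessThan del: sum.lessThan_Suc)
    also have "\<dots> = (\<Sum>k<Suc n. of_bool (k = i) * (of_bool (i = j)) - of_bool (k = j) * (c * w i * w j)
        - of_bool (k = i) * (c * w i * w j) + w i * w j * (c * c * (w k * w k)))"
      by (intro sum.cong refl) (auto simp: algebra_simps)
    also have "\<dots> = of_bool (i = j) - c * w i * w j - c * w i * w j + w i * w j * (c * c * (\<Sum>k<Suc n. w k * w k))"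
      unfolding sum.distrib sum_subtractf sum_distrib_left[symmetric] sum_distrib_right[symmetric]
      using ij by simp
    also have "\<dots> = 1\<^sub>m (Suc n) $$ (i,j)" unfolding cc using ij by (simp add: algebra_simps)
    finally show "(W * W) $$ (i,j) = 1\<^sub>m (Suc n) $$ (i,j)" .
  qed (auto simp: W_def)
  moreover have "W *\<^sub>v unit_vec (Suc n) 0 = v"
  proof (rule eq_vecI)
    fix i assume "i < dim_vec v"
    then have i: "i < Suc n" using v by simp
    have one: "c * w i * w 0 = w i"
    proof (cases "v $ 0 = 1")
      \<comment> \<open>Here \<open>w\<close> vanishes on all indices, since its squared norm is
        \<open>2 * (1 - v $ 0)\<close>.\<close>
      case True
      have "(\<Sum>i<Suc n. w i * w i) = 0" unfolding ww True by simp
      then have "w i * w i = 0" using i by (subst (asm) sum_nonneg_eq_0_iff) auto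
      then show ?thesis by simp
    qed (simp add: c_def w_def)
    have "(W *\<^sub>v unit_vec (Suc n) 0) $ i = W $$ (i, 0)"
      using i W by simp
    also have "\<dots> = of_bool (i = 0) - c * w i * w 0" using i by (simp add: W_def)
    also have "\<dots> = v $ i" unfolding one by (simp add: w_def)
    finally show "(W *\<^sub>v unit_vec (Suc n) 0) $ i = v $ i" .
  qed (use v W in auto)
  ultimately show ?thesis using that W by blast
qed

text \<open>Deflation: conjugating by the reflection that sends the first unit vector to a unit
  eigenvector clears the first row and column outside the corner, and the induction hypothesis
  diagonalizes the remaining block.\<close>

lemma symmetric_mat_orthogonally_diagonalizable:
  fixes A :: "real mat"
  assumes "A \<in> carrier_mat n n" "A\<^sup>T = A"
  shows "\<exists>U D. U \<in> carrier_mat n n \<and> D \<in> carrier_mat n n \<and> U\<^sup>T * U = 1\<^sub>m n \<and>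
    diagonal_mat D \<and> A = U * D * U\<^sup>T"
  using assms
proof (induction n arbitrary: A)
  case 0
  then show ?case by (intro exI[of _ A]) (auto simp: diagonal_mat_def)
next
  case (Suc n)
  let ?n = "Suc n"
  let ?e = "unit_vec ?n 0 :: real vec"
  note A = Suc.prems(1)
  obtain v l where v: "v \<in> carrier_vec ?n" "v \<bullet> v = 1" "A *\<^sub>v v = l \<cdot>\<^sub>v v"
    using symmetric_mat_real_eigenvector[OF Suc.prems] by auto
  obtain W where W: "W \<in> carrier_mat ?n ?n" "W\<^sup>T = W" "W * W = 1\<^sub>m ?n" "W *\<^sub>v ?e = v"
    using reflection_with_first_column[OF v(1,2)] by blast
  have WAc: "W * A \<in> carrier_mat ?n ?n" using W A by simp
  define B where "B = W * A * W"
  have B: "B \<in> carrier_mat ?n ?n" using W A by (simp add: B_def)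
  have sB: "B\<^sup>T = B"
    using W A Suc.prems(2) WAc
    by (simp add: B_def transpose_mult[of _ ?n ?n _ ?n] assoc_mult_mat[of _ ?n ?n _ ?n _ ?n])
  have Wv: "W *\<^sub>v v = ?e"
    using W by (metis assoc_mult_mat_vec one_mult_mat_vec unit_vec_carrier)
  have "B *\<^sub>v ?e = (W * A) *\<^sub>v (W *\<^sub>v ?e)"
    unfolding B_def by (rule assoc_mult_mat_vec[OF WAc W(1)]) simp
  also have "\<dots> = W *\<^sub>v (A *\<^sub>v v)" unfolding W(4) by (rule assoc_mult_mat_vec[OF W(1) A v(1)])
  also have "\<dots> = l \<cdot>\<^sub>v ?e" unfolding v(3) using mult_mat_vec[OF W(1) v(1)] Wv by simp
  finally have Be: "B *\<^sub>v ?e = l \<cdot>\<^sub>v ?e" .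
  have Bi0: "B $$ (i,0) = l * of_bool (i = 0)" if "i < ?n" for i
  proof -
    have "B $$ (i,0) = (B *\<^sub>v ?e) $ i" using that B by simp
    then show ?thesis unfolding Be using that by simp
  qed
  have B0i: "B $$ (0,i) = l * of_bool (i = 0)" if "i < ?n" for i
    using Bi0[OF that] sB B that by (metis carrier_matD index_transpose_mat(1) zero_less_Suc)
  define B' where "B' = mat n n (\<lambda>(i,j). B $$ (Suc i, Suc j))"
  have B': "B' \<in> carrier_mat n n" "B'\<^sup>T = B'"
  proof -
    show "B' \<in> carrier_mat n n" by (simp add: B'_def)
    have "B $$ (i,j) = B $$ (j,i)" if "i < ?n" "j < ?n" for i j
      using sB B that by (metis carrier_matD index_transpose_mat(1))
    then show "B'\<^sup>T = B'" by (intro eq_matI) (auto simp: B'_def)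
  qed
  define Lm where "Lm = mat 1 1 (\<lambda>_. l)"
  have Lm: "Lm \<in> carrier_mat 1 1" by (simp add: Lm_def)
  have Bblock: "B = four_block_mat Lm (0\<^sub>m 1 n) (0\<^sub>m n 1) B'"
    using B Bi0 B0i by (intro eq_matI) (auto simp: four_block_mat_def B'_def Lm_def)
  obtain U D where U: "U \<in> carrier_mat n n" and D: "D \<in> carrier_mat n n" and UU: "U\<^sup>T * U = 1\<^sub>m n"
    and dD: "diagonal_mat D" and B'eq: "B' = U * D * U\<^sup>T"
    using Suc.IH[OF B'] by blast
  \<comment> \<open>\<open>V\<close> extends the diagonalizer of the smaller block by a fixed first
    coordinate, so that \<open>W * V\<close> diagonalizes \<open>A\<close>.\<close>
  define V where "V = four_block_mat (1\<^sub>m 1) (0\<^sub>m 1 n) (0\<^sub>m n 1) U"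
  define E where "E = four_block_mat Lm (0\<^sub>m 1 n) (0\<^sub>m n 1) D"
  have V: "V \<in> carrier_mat ?n ?n" and E: "E \<in> carrier_mat ?n ?n"
    using U D Lm by (auto simp: V_def E_def)
  have VT: "V\<^sup>T = four_block_mat (1\<^sub>m 1) (0\<^sub>m 1 n) (0\<^sub>m n 1) U\<^sup>T"
    using U unfolding V_def by (subst transpose_four_block_mat[of _ 1 1 _ n _ n]) auto
  have UT: "U\<^sup>T \<in> carrier_mat n n" using U by simp
  have one: "four_block_mat (1\<^sub>m 1) (0\<^sub>m 1 n) (0\<^sub>m n 1) (1\<^sub>m n) = (1\<^sub>m ?n :: real mat)"
    by (intro eq_matI) (auto simp: four_block_mat_def)
  have VV: "V\<^sup>T * V = 1\<^sub>m ?n"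
    unfolding VT unfolding V_def
    apply (subst mult_four_block_mat[of _ 1 1 _ n _ n _ _ 1 _ n])
    using U UT by (auto simp: UU one)
  have VE: "V * E = four_block_mat Lm (0\<^sub>m 1 n) (0\<^sub>m n 1) (U * D)"
    unfolding V_def E_def
    apply (subst mult_four_block_mat[of _ 1 1 _ n _ n _ _ 1 _ n])
    using U D Lm by auto
  have UD: "U * D \<in> carrier_mat n n" using U D by simp
  have VEV: "V * E * V\<^sup>T = B"
    unfolding VE VT Bblock B'eq
    apply (subst mult_four_block_mat[of _ 1 1 _ n _ n _ _ 1 _ n])
    using UD UT Lm by auto
  have dE: "diagonal_mat E"
    using dD D unfolding diagonal_mat_def E_def by (auto simp: four_block_mat_def Lm_def)
  have assoc: "X * Y * Z = X * (Y * Z)"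
    if "X \<in> carrier_mat ?n ?n" "Y \<in> carrier_mat ?n ?n" "Z \<in> carrier_mat ?n ?n" for X Y Z :: "real mat"
    using assoc_mult_mat[OF that] .
  have c: "X * Y \<in> carrier_mat ?n ?n"
    if "X \<in> carrier_mat ?n ?n" "Y \<in> carrier_mat ?n ?n" for X Y :: "real mat" using that by simp
  note VTc = transpose_carrier_mat[THEN iffD2, OF V]
  have cancel: "W * (W * X) = X" if "X \<in> carrier_mat ?n ?n" for X
    using W that by (metis assoc left_mult_one_mat)
  have WVT: "(W * V)\<^sup>T = V\<^sup>T * W" using transpose_mult[OF W(1) V] W(2) by simp
  show ?case
  proof (rule exI[of _ "W * V"], rule exI[of _ E], intro conjI)
    show "(W * V)\<^sup>T * (W * V) = 1\<^sub>m ?n"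
      unfolding WVT using VV W V VTc cancel by (simp add: assoc c)
    have "W * V * E * (W * V)\<^sup>T = W * (V * E * V\<^sup>T) * W"
      unfolding WVT using W V VTc E by (simp add: assoc c)
    also have "\<dots> = A" unfolding VEV B_def using W A cancel by (simp add: assoc c)
    finally show "A = W * V * E * (W * V)\<^sup>T" ..
  qed (use W V E dE in auto)
qed

section \<open>From orthogonal diagonalization to the trace norm\<close>

lemma proots_linear_factors:
  fixes xs :: "'a :: idom list"
  shows "proots (\<Prod>x\<leftarrow>xs. [:- x, 1:]) = mset xs"
proof (induction xs)
  case (Cons x xs)
  have "(\<Prod>x\<leftarrow>xs. [:- x, 1:]) \<noteq> 0" by (auto simp: prod_list_zero_iff)
  then have "proots ([:- x, 1:] * (\<Prod>x\<leftarrow>xs. [:- x, 1:])) = add_mset x (mset xs)"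
    by (subst proots_mult) (simp_all add: Cons.IH)
  then show ?case by (simp only: list.map prod_list.Cons mset.simps)
qed simp

text \<open>Column \<open>k\<close> is meant as the \<open>k\<close>-th eigenvector. Orthonormality
  of columns and of rows are both recorded, so that neither has to be derived from the
  other.\<close>

definition orthogonal_array :: "nat \<Rightarrow> (nat \<Rightarrow> nat \<Rightarrow> real) \<Rightarrow> bool" where
  "orthogonal_array n u \<longleftrightarrow>
     (\<forall>k<n. \<forall>m<n. (\<Sum>i<n. u i k * u i m) = of_bool (k = m)) \<and>
     (\<forall>i<n. \<forall>j<n. (\<Sum>k<n. u i k * u j k) = of_bool (i = j))"

text \<open>For symmetric matrices this is the sum of the singular values, that is, the nuclear
  norm. Both energies are instances of it.\<close>

definition trace_norm :: "real mat \<Rightarrow> real" where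
  "trace_norm M = (\<Sum>z\<in>#eigenvalue_mset M. cmod z)"

text \<open>The bridge from matrices and characteristic polynomials to finite sums over indices; the
  later spectral arguments use only these sums.\<close>

lemma spectral_array:
  fixes a :: "nat \<Rightarrow> nat \<Rightarrow> real"
  assumes sym: "\<And>i j. i < n \<Longrightarrow> j < n \<Longrightarrow> a i j = a j i"
  obtains u l where "orthogonal_array n u"
    "\<And>i j. i < n \<Longrightarrow> j < n \<Longrightarrow> a i j = (\<Sum>k<n. l k * u i k * u j k)"
    "trace_norm (mat n n (\<lambda>(i, j). a i j)) = (\<Sum>k<n. \<bar>l k\<bar>)"
proof -
  let ?A = "mat n n (\<lambda>(i, j). a i j)"
  have A: "?A \<in> carrier_mat n n" by simp
  have "?A\<^sup>T = ?A" using sym by (intro eq_matI) auto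
  then obtain U D where U: "U \<in> carrier_mat n n" and D: "D \<in> carrier_mat n n" and UU: "U\<^sup>T * U = 1\<^sub>m n"
    and dD: "diagonal_mat D" and eq: "?A = U * D * U\<^sup>T"
    using symmetric_mat_orthogonally_diagonalizable[OF A] by blast
  have UT: "U\<^sup>T \<in> carrier_mat n n" using U by simp
  have UU': "U * U\<^sup>T = 1\<^sub>m n" using mat_mult_left_right_inverse[OF UT U UU] .
  define u where "u i k = U $$ (i,k)" for i k
  define l where "l k = D $$ (k,k)" for k
  have "orthogonal_array n u"
    unfolding orthogonal_array_def
  proof (intro conjI allI impI)
    fix k m assume km: "k < n" "m < n"
    have "(U\<^sup>T * U) $$ (k,m) = (\<Sum>i<n. u i k * u i m)"
      using km U by (simp add: scalar_prod_def atLeast0LessThan u_def)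
    then show "(\<Sum>i<n. u i k * u i m) = of_bool (k = m)" unfolding UU using km by (auto split: if_splits)
    have "(U * U\<^sup>T) $$ (k,m) = (\<Sum>i<n. u k i * u m i)"
      using km U by (simp add: scalar_prod_def atLeast0LessThan u_def)
    then show "(\<Sum>i<n. u k i * u m i) = of_bool (k = m)" unfolding UU' using km by (auto split: if_splits)
  qed
  moreover have "a i j = (\<Sum>k<n. l k * u i k * u j k)" if "i < n" "j < n" for i j
  proof -
    have UDij: "(U * D) $$ (i,k) = u i k * l k" if "k < n" for k
    proof -
      have "(U * D) $$ (i,k) = (\<Sum>m<n. U $$ (i,m) * D $$ (m,k))"
        using U D that \<open>i < n\<close> by (simp add: scalar_prod_def atLeast0LessThan)
      also have "\<dots> = (\<Sum>m<n. if m = k then u i k * l k else 0)"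
        using dD D that by (intro sum.cong refl) (auto simp: diagonal_mat_def u_def l_def)
      finally show ?thesis using that by simp
    qed
    have "a i j = (U * D * U\<^sup>T) $$ (i,j)" using that by (simp flip: eq)
    also have "\<dots> = (\<Sum>k<n. (U * D) $$ (i,k) * U $$ (j,k))"
      using that U mult_carrier_mat[OF U D]
      by (subst index_mult_mat) (auto simp del: index_mult_mat simp: scalar_prod_def atLeast0LessThan)
    also have "\<dots> = (\<Sum>k<n. l k * u i k * u j k)"
      by (intro sum.cong refl) (simp add: UDij, simp add: u_def)
    finally show ?thesis .
  qed
  moreover have "trace_norm ?A = (\<Sum>k<n. \<bar>l k\<bar>)"
  proof -
    have "similar_mat ?A D"
      unfolding similar_mat_def using similar_mat_witI[OF UU' UU eq A D U UT] by blast
    then have "char_poly ?A = char_poly D" by (rule char_poly_similar)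
    also have "\<dots> = (\<Prod>a\<leftarrow>diag_mat D. [:- a, 1:])"
      using dD D by (intro char_poly_upper_triangular[of _ n]) (auto simp: diagonal_mat_def)
    also have "diag_mat D = map l [0..<n]" using D by (simp add: diag_mat_def l_def)
    finally have cp: "char_poly ?A = (\<Prod>a\<leftarrow>map l [0..<n]. [:- a, 1:])" .
    \<comment> \<open>Characteristic polynomials commute with the embedding of the reals, so the
      complex eigenvalue multiset consists of the real numbers \<open>l k\<close>.\<close>
    have "char_poly (map_mat complex_of_real ?A) = map_poly complex_of_real (char_poly ?A)"
      by (rule of_real_hom.char_poly_hom[OF A])
    also have "\<dots> = (\<Prod>k\<leftarrow>[0..<n]. [:- complex_of_real (l k), 1:])"
    proof -
      interpret map_poly_hom: map_poly_comm_ring_hom complex_of_real ..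
      show ?thesis unfolding cp map_poly_hom.hom_prod_list by (simp add: o_def)
    qed
    also have "proots \<dots> = mset (map (\<lambda>k. complex_of_real (l k)) [0..<n])"
      using proots_linear_factors[of "map (\<lambda>k. complex_of_real (l k)) [0..<n]"]
      by (simp only: map_map o_def)
    finally have "eigenvalue_mset ?A = mset (map (\<lambda>k. complex_of_real (l k)) [0..<n])"
      unfolding eigenvalue_mset_def .
    then have "trace_norm ?A = sum_list (map cmod (map (\<lambda>k. complex_of_real (l k)) [0..<n]))"
      unfolding trace_norm_def by (simp only: mset_map[symmetric] sum_mset_sum_list)
    then show ?thesis by (simp add: o_def interv_sum_list_conv_sum_set_nat atLeast0LessThan)
  qed
  ultimately show ?thesis using that by blast
qed

subsection \<open>Trace norm: moments and duality\<close>

lemma sum_mult_of_bool_eq_single: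
  fixes f :: "nat \<Rightarrow> real"
  assumes "i < n"
  shows "(\<Sum>j<n. f j * of_bool (i = j)) = f i" "(\<Sum>j<n. f j * of_bool (j = i)) = f i"
proof -
  have "(\<Sum>j<n. f j * of_bool (i = j)) = (\<Sum>j<n. if i = j then f j else 0)"
    by (intro sum.cong refl) auto
  then show "(\<Sum>j<n. f j * of_bool (i = j)) = f i" using assms by simp
  then show "(\<Sum>j<n. f j * of_bool (j = i)) = f i" by (simp only: eq_commute[of i])
qed

lemma sum_mult_pick:
  fixes w :: "nat \<Rightarrow> nat \<Rightarrow> real"
  assumes "i < n" "j < n"
  shows "(\<Sum>k<n. \<Sum>l<n. w k l * (of_bool (k = i) * of_bool (l = j))) = w i j"
proof -
  have "(\<Sum>k<n. \<Sum>l<n. w k l * (of_bool (k = i) * of_bool (l = j))) =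
      (\<Sum>k<n. \<Sum>l<n. w k l * of_bool (k = i) * of_bool (l = j))"
    by (simp only: mult.assoc)
  also have "\<dots> = w i j"
    unfolding sum_mult_of_bool_eq_single(2)[OF assms(2)] sum_mult_of_bool_eq_single(2)[OF assms(1)] ..
  finally show ?thesis .
qed

lemma orthogonal_array_Parseval:
  assumes "orthogonal_array n u"
  shows "(\<Sum>k<n. (\<Sum>i<n. u i k * x i)\<^sup>2) = (\<Sum>i<n. (x i)\<^sup>2)"
proof -
  have "(\<Sum>k<n. (\<Sum>i<n. u i k * x i)\<^sup>2) = (\<Sum>k<n. \<Sum>i<n. \<Sum>j<n. x i * x j * (u i k * u j k))"
    by (simp add: power2_eq_square sum_product mult_ac)
  also have "\<dots> = (\<Sum>i<n. \<Sum>j<n. \<Sum>k<n. x i * x j * (u i k * u j k))"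
    by (subst sum.swap) (rule sum.cong[OF refl], rule sum.swap)
  also have "\<dots> = (\<Sum>i<n. \<Sum>j<n. x i * x j * of_bool (i = j))"
    using assms by (intro sum.cong refl) (simp add: orthogonal_array_def flip: sum_distrib_left)
  also have "\<dots> = (\<Sum>i<n. (x i)\<^sup>2)"
    by (intro sum.cong refl) (simp add: sum_mult_of_bool_eq_single power2_eq_square del: sum_mult_of_bool_eq)
  finally show ?thesis .
qed

text \<open>Matrices with common eigenvectors multiply eigenvalue by eigenvalue, because column
  orthonormality removes the cross terms.\<close>

lemma spectral_array_mult:
  assumes u: "orthogonal_array n u"
    and f: "\<And>i j. i < n \<Longrightarrow> j < n \<Longrightarrow> f i j = (\<Sum>k<n. l k * u i k * u j k)"
    and g: "\<And>i j. i < n \<Longrightarrow> j < n \<Longrightarrow> g i j = (\<Sum>k<n. m k * u i k * u j k)"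
    and ij: "i < n" "j < n"
  shows "(\<Sum>k<n. f i k * g k j) = (\<Sum>k<n. (l k * m k) * u i k * u j k)"
proof -
  have "(\<Sum>k<n. f i k * g k j) =
      (\<Sum>k<n. \<Sum>s<n. \<Sum>t<n. (l s * u i s * m t * u j t) * (u k s * u k t))"
    using ij by (intro sum.cong refl) (simp add: f g sum_product mult_ac)
  also have "\<dots> = (\<Sum>s<n. \<Sum>t<n. \<Sum>k<n. (l s * u i s * m t * u j t) * (u k s * u k t))"
    by (subst sum.swap) (rule sum.cong[OF refl], rule sum.swap)
  also have "\<dots> = (\<Sum>s<n. \<Sum>t<n. (l s * u i s * m t * u j t) * of_bool (s = t))"
    using u by (intro sum.cong refl) (simp add: orthogonal_array_def flip: sum_distrib_left)
  also have "\<dots> = (\<Sum>k<n. (l k * m k) * u i k * u j k)"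
    by (intro sum.cong refl) (simp add: sum_mult_of_bool_eq_single del: sum_mult_of_bool_eq)
  finally show ?thesis .
qed

text \<open>By symmetry the left side is the trace of the square of \<open>f\<close>.\<close>

lemma spectral_array_square_sum:
  assumes u: "orthogonal_array n u"
    and f: "\<And>i j. i < n \<Longrightarrow> j < n \<Longrightarrow> f i j = (\<Sum>k<n. l k * u i k * u j k)"
  shows "(\<Sum>i<n. \<Sum>j<n. (f i j)\<^sup>2) = (\<Sum>k<n. (l k)\<^sup>2)"
proof -
  have sym: "f i j = f j i" if "i < n" "j < n" for i j using that by (simp add: f mult_ac)
  have "(\<Sum>i<n. \<Sum>j<n. (f i j)\<^sup>2) = (\<Sum>i<n. \<Sum>j<n. f i j * f j i)"
    by (intro sum.cong refl) (simp add: sym power2_eq_square)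
  also have "\<dots> = (\<Sum>i<n. \<Sum>k<n. (l k * l k) * u i k * u i k)"
    by (rule sum.cong[OF refl], rule spectral_array_mult[OF u]) (auto simp: f)
  also have "\<dots> = (\<Sum>k<n. \<Sum>i<n. (l k * l k) * (u i k * u i k))"
    by (subst sum.swap) (simp add: mult_ac)
  also have "\<dots> = (\<Sum>k<n. (l k)\<^sup>2)"
    using u by (intro sum.cong refl) (simp add: orthogonal_array_def power2_eq_square flip: sum_distrib_left)
  finally show ?thesis .
qed

definition array_mult :: "nat \<Rightarrow> (nat \<Rightarrow> nat \<Rightarrow> real) \<Rightarrow> (nat \<Rightarrow> nat \<Rightarrow> real) \<Rightarrow> nat \<Rightarrow> nat \<Rightarrow> real" where
  "array_mult n a b i j = (\<Sum>k<n. a i k * b k j)"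

definition frobenius_sq :: "nat \<Rightarrow> (nat \<Rightarrow> nat \<Rightarrow> real) \<Rightarrow> real" where
  "frobenius_sq n a = (\<Sum>i<n. \<Sum>j<n. (a i j)\<^sup>2)"

abbreviation array_trace_norm :: "nat \<Rightarrow> (nat \<Rightarrow> nat \<Rightarrow> real) \<Rightarrow> real" where
  "array_trace_norm n a \<equiv> trace_norm (mat n n (\<lambda>(i, j). a i j))"

text \<open>Squared Frobenius norms of the first three powers are the traces of the powers 2, 4 and
  6. In this form they are sums of squares of single entries, whose expectations are
  accessible.\<close>

lemma trace_norm_moments:
  assumes sym: "\<And>i j. i < n \<Longrightarrow> j < n \<Longrightarrow> a i j = a j i"
  obtains l :: "nat \<Rightarrow> real" where "array_trace_norm n a = (\<Sum>k<n. \<bar>l k\<bar>)"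
    "frobenius_sq n a = (\<Sum>k<n. l k ^ 2)"
    "frobenius_sq n (array_mult n a a) = (\<Sum>k<n. l k ^ 4)"
    "frobenius_sq n (array_mult n (array_mult n a a) a) = (\<Sum>k<n. l k ^ 6)"
proof -
  obtain u l where u: "orthogonal_array n u"
    and a: "\<And>i j. i < n \<Longrightarrow> j < n \<Longrightarrow> a i j = (\<Sum>k<n. l k * u i k * u j k)"
    and tn: "array_trace_norm n a = (\<Sum>k<n. \<bar>l k\<bar>)"
    using spectral_array[of n a] sym by blast
  have a2: "array_mult n a a i j = (\<Sum>k<n. (l k * l k) * u i k * u j k)" if "i < n" "j < n" for i j
    unfolding array_mult_def by (rule spectral_array_mult[OF u a a that])
  have a3: "array_mult n (array_mult n a a) a i j = (\<Sum>k<n. (l k * l k * l k) * u i k * u j k)"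
    if "i < n" "j < n" for i j
    unfolding array_mult_def[of n "array_mult n a a" a] by (rule spectral_array_mult[OF u a2 a that])
  have "frobenius_sq n a = (\<Sum>k<n. l k ^ 2)"
    unfolding frobenius_sq_def by (rule spectral_array_square_sum[OF u a])
  moreover have "frobenius_sq n (array_mult n a a) = (\<Sum>k<n. l k ^ 4)"
  proof -
    have "frobenius_sq n (array_mult n a a) = (\<Sum>k<n. (l k * l k)\<^sup>2)"
      unfolding frobenius_sq_def by (rule spectral_array_square_sum[OF u]) (rule a2)
    then show ?thesis by (simp add: power2_eq_square power4_eq_xxxx mult.assoc)
  qed
  moreover have "frobenius_sq n (array_mult n (array_mult n a a) a) = (\<Sum>k<n. l k ^ 6)"
  proof -
    have "frobenius_sq n (array_mult n (array_mult n a a) a) = (\<Sum>k<n. (l k * l k * l k)\<^sup>2)"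
      unfolding frobenius_sq_def by (rule spectral_array_square_sum[OF u]) (rule a3)
    then show ?thesis by (simp add: power2_eq_square numeral_eq_Suc mult.assoc)
  qed
  ultimately show ?thesis using tn that by blast
qed

section \<open>Duality between the trace norm and contractions\<close>

text \<open>The bilinear form has operator norm at most 1; the AM-GM version of the bound avoids square roots.\<close>

definition form_contraction :: "nat \<Rightarrow> (nat \<Rightarrow> nat \<Rightarrow> real) \<Rightarrow> bool" where
  "form_contraction n w \<longleftrightarrow>
     (\<forall>x y. \<bar>\<Sum>i<n. \<Sum>j<n. w i j * x i * y j\<bar> \<le> ((\<Sum>i<n. (x i)\<^sup>2) + (\<Sum>i<n. (y i)\<^sup>2)) / 2)"

text \<open>In the eigenbasis the form is diagonal with coefficients \<open>s k\<close>; AM-GM on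
  each term and Parseval give the bound.\<close>

lemma form_contraction_of_signs:
  assumes u: "orthogonal_array n u" and s: "\<And>k. k < n \<Longrightarrow> \<bar>s k\<bar> \<le> 1"
  shows "form_contraction n (\<lambda>i j. \<Sum>k<n. s k * u i k * u j k)"
  unfolding form_contraction_def
proof (intro allI)
  fix x y :: "nat \<Rightarrow> real"
  let ?X = "\<lambda>k. \<Sum>i<n. u i k * x i" and ?Y = "\<lambda>k. \<Sum>i<n. u i k * y i"
  have "(\<Sum>i<n. \<Sum>j<n. (\<Sum>k<n. s k * u i k * u j k) * x i * y j) =
      (\<Sum>i<n. \<Sum>j<n. \<Sum>k<n. s k * (u i k * x i) * (u j k * y j))"
    by (simp add: sum_distrib_right mult.assoc mult.left_commute)
  also have "\<dots> = (\<Sum>i<n. \<Sum>k<n. \<Sum>j<n. s k * (u i k * x i) * (u j k * y j))"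
    by (rule sum.cong[OF refl], rule sum.swap)
  also have "\<dots> = (\<Sum>k<n. \<Sum>i<n. \<Sum>j<n. s k * (u i k * x i) * (u j k * y j))"
    by (rule sum.swap)
  also have "\<dots> = (\<Sum>k<n. s k * (?X k * ?Y k))"
    by (rule sum.cong[OF refl]) (simp only: sum_product, simp only: sum_distrib_left mult.assoc)
  also have "\<bar>\<dots>\<bar> \<le> (\<Sum>k<n. \<bar>s k * (?X k * ?Y k)\<bar>)" by (rule sum_abs)
  also have "\<dots> \<le> (\<Sum>k<n. ((?X k)\<^sup>2 + (?Y k)\<^sup>2) / 2)"
  proof (rule sum_mono)
    fix k assume "k \<in> {..<n}"
    then have "\<bar>s k * (?X k * ?Y k)\<bar> \<le> \<bar>?X k * ?Y k\<bar>"
      using s[of k] by (simp add: abs_mult mult_left_le_one_le)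
    also have "\<dots> \<le> ((?X k)\<^sup>2 + (?Y k)\<^sup>2) / 2"
      using sum_squares_bound[of "\<bar>?X k\<bar>" "\<bar>?Y k\<bar>"] by (simp add: abs_mult)
    finally show "\<bar>s k * (?X k * ?Y k)\<bar> \<le> ((?X k)\<^sup>2 + (?Y k)\<^sup>2) / 2" .
  qed
  also have "\<dots> = ((\<Sum>i<n. (x i)\<^sup>2) + (\<Sum>i<n. (y i)\<^sup>2)) / 2"
    by (simp add: sum.distrib orthogonal_array_Parseval[OF u] flip: sum_divide_distrib)
  finally show "\<bar>\<Sum>i<n. \<Sum>j<n. (\<Sum>k<n. s k * u i k * u j k) * x i * y j\<bar>
      \<le> ((\<Sum>i<n. (x i)\<^sup>2) + (\<Sum>i<n. (y i)\<^sup>2)) / 2" .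
qed

text \<open>Expanding \<open>a\<close> spectrally leaves the values of the form \<open>w\<close> at
  unit eigenvectors, each at most 1 in absolute value, weighted by the eigenvalues.\<close>

lemma trace_norm_dual_upper:
  assumes sym: "\<And>i j. i < n \<Longrightarrow> j < n \<Longrightarrow> a i j = a j i" and w: "form_contraction n w"
  shows "(\<Sum>i<n. \<Sum>j<n. w i j * a i j) \<le> array_trace_norm n a"
proof -
  obtain u l where u: "orthogonal_array n u"
    and a: "\<And>i j. i < n \<Longrightarrow> j < n \<Longrightarrow> a i j = (\<Sum>k<n. l k * u i k * u j k)"
    and tn: "array_trace_norm n a = (\<Sum>k<n. \<bar>l k\<bar>)"
    using spectral_array[of n a] sym by blast
  have "(\<Sum>i<n. \<Sum>j<n. w i j * a i j) = (\<Sum>i<n. \<Sum>j<n. \<Sum>k<n. l k * (w i j * u i k * u j k))"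
    by (intro sum.cong refl) (simp add: a sum_distrib_left mult_ac)
  also have "\<dots> = (\<Sum>i<n. \<Sum>k<n. \<Sum>j<n. l k * (w i j * u i k * u j k))"
    by (rule sum.cong[OF refl], rule sum.swap)
  also have "\<dots> = (\<Sum>k<n. \<Sum>i<n. \<Sum>j<n. l k * (w i j * u i k * u j k))"
    by (rule sum.swap)
  also have "\<dots> \<le> (\<Sum>k<n. \<bar>l k\<bar>)"
  proof (rule sum_mono)
    fix k assume k: "k \<in> {..<n}"
    have "(\<Sum>i<n. (u i k)\<^sup>2) = 1"
      using u k by (simp add: orthogonal_array_def power2_eq_square)
    then have 1: "\<bar>\<Sum>i<n. \<Sum>j<n. w i j * u i k * u j k\<bar> \<le> 1"
      using w[unfolded form_contraction_def, rule_format, of "\<lambda>i. u i k" "\<lambda>i. u i k"] by simp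
    have "(\<Sum>i<n. \<Sum>j<n. l k * (w i j * u i k * u j k)) = l k * (\<Sum>i<n. \<Sum>j<n. w i j * u i k * u j k)"
      by (simp add: sum_distrib_left)
    also have "\<dots> \<le> \<bar>l k\<bar> * \<bar>\<Sum>i<n. \<Sum>j<n. w i j * u i k * u j k\<bar>"
      unfolding abs_mult[symmetric] by (rule abs_ge_self)
    also have "\<dots> \<le> \<bar>l k\<bar> * 1" by (rule mult_left_mono[OF 1 abs_ge_zero])
    finally show "(\<Sum>i<n. \<Sum>j<n. l k * (w i j * u i k * u j k)) \<le> \<bar>l k\<bar>" by simp
  qed
  finally show ?thesis unfolding tn .
qed

text \<open>The optimal contraction is the matrix sign of \<open>a\<close>: the same eigenvectors,
  with each eigenvalue replaced by its sign.\<close>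

lemma trace_norm_dual_attained:
  assumes sym: "\<And>i j. i < n \<Longrightarrow> j < n \<Longrightarrow> a i j = a j i"
  obtains w where "form_contraction n w" "array_trace_norm n a = (\<Sum>i<n. \<Sum>j<n. w i j * a i j)"
proof -
  obtain u l where u: "orthogonal_array n u"
    and a: "\<And>i j. i < n \<Longrightarrow> j < n \<Longrightarrow> a i j = (\<Sum>k<n. l k * u i k * u j k)"
    and tn: "array_trace_norm n a = (\<Sum>k<n. \<bar>l k\<bar>)"
    using spectral_array[of n a] sym by blast
  define w where "w = (\<lambda>i j. \<Sum>k<n. sgn (l k) * u i k * u j k)"
  have fc: "form_contraction n w"
    unfolding w_def by (rule form_contraction_of_signs[OF u]) (simp add: abs_sgn_eq)
  \<comment> \<open>Transposing \<open>a\<close> turns the entrywise pairing into the trace of a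
    product, which the common eigenvectors diagonalize.\<close>
  have "(\<Sum>i<n. \<Sum>j<n. w i j * a i j) = (\<Sum>i<n. \<Sum>j<n. w i j * a j i)"
    by (intro sum.cong refl) (simp add: sym)
  also have "\<dots> = (\<Sum>i<n. \<Sum>k<n. (sgn (l k) * l k) * u i k * u i k)"
    by (intro sum.cong refl spectral_array_mult[OF u _ a]) (auto simp: w_def)
  also have "\<dots> = (\<Sum>k<n. \<Sum>i<n. \<bar>l k\<bar> * (u i k * u i k))"
    by (subst sum.swap) (simp add: abs_sgn mult_ac)
  also have "\<dots> = (\<Sum>k<n. \<bar>l k\<bar>)"
    using u by (intro sum.cong refl) (simp add: orthogonal_array_def flip: sum_distrib_left)
  finally show ?thesis using that[OF fc] tn by simp
qed

text \<open>The contraction that is optimal for \<open>b\<close> is tested against \<open>a\<close>.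
  Bounding the pairing with the difference is then enough, and no norm of the difference has to be
  computed.\<close>

lemma trace_norm_perturb:
  assumes a: "\<And>i j. i < n \<Longrightarrow> j < n \<Longrightarrow> a i j = a j i"
    and b: "\<And>i j. i < n \<Longrightarrow> j < n \<Longrightarrow> b i j = b j i"
    and c: "\<And>w. form_contraction n w \<Longrightarrow> (\<Sum>i<n. \<Sum>j<n. w i j * (b i j - a i j)) \<le> c"
  shows "array_trace_norm n b \<le> array_trace_norm n a + c"
proof -
  obtain w where w: "form_contraction n w" "array_trace_norm n b = (\<Sum>i<n. \<Sum>j<n. w i j * b i j)"
    using trace_norm_dual_attained[of n b] b by blast
  have "(\<Sum>i<n. \<Sum>j<n. w i j * b i j) =
      (\<Sum>i<n. \<Sum>j<n. w i j * a i j) + (\<Sum>i<n. \<Sum>j<n. w i j * (b i j - a i j))"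
    by (simp add: sum_subtractf right_diff_distrib)
  also have "\<dots> \<le> array_trace_norm n a + c"
    using trace_norm_dual_upper[of n a w, OF a w(1)] c[OF w(1)] by simp
  finally show ?thesis using w by simp
qed

lemma trace_norm_diff_le:
  assumes a: "\<And>i j. i < n \<Longrightarrow> j < n \<Longrightarrow> a i j = a j i"
    and b: "\<And>i j. i < n \<Longrightarrow> j < n \<Longrightarrow> b i j = b j i"
    and c: "\<And>w. form_contraction n w \<Longrightarrow> \<bar>\<Sum>i<n. \<Sum>j<n. w i j * (b i j - a i j)\<bar> \<le> c"
  shows "\<bar>array_trace_norm n b - array_trace_norm n a\<bar> \<le> c"
proof -
  have neg: "(\<Sum>i<n. \<Sum>j<n. w i j * (a i j - b i j)) = - (\<Sum>i<n. \<Sum>j<n. w i j * (b i j - a i j))" for w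
    by (simp add: right_diff_distrib sum_subtractf)
  have "array_trace_norm n b \<le> array_trace_norm n a + c"
    by (rule trace_norm_perturb[OF a b]) (use c in \<open>auto simp: abs_le_iff\<close>)
  moreover have "array_trace_norm n a \<le> array_trace_norm n b + c"
    by (rule trace_norm_perturb[OF b a]) (use c neg in \<open>auto simp: abs_le_iff\<close>)
  ultimately show ?thesis by linarith
qed

text \<open>The test vectors are two unit vectors, the all-ones vector of squared norm
  \<open>n\<close>, and the difference of two unit vectors, of squared norm 2.\<close>

lemma form_contraction_bounds:
  assumes w: "form_contraction n w"
  shows "i < n \<Longrightarrow> j < n \<Longrightarrow> \<bar>w i j\<bar> \<le> 1"
    and "\<bar>\<Sum>i<n. \<Sum>j<n. w i j\<bar> \<le> real n"
    and "i < n \<Longrightarrow> j < n \<Longrightarrow> i \<noteq> j \<Longrightarrow> \<bar>w i i + w j j - w i j - w j i\<bar> \<le> 2"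
proof -
  note W = w[unfolded form_contraction_def, rule_format]
  have pick: "(\<Sum>s<n. \<Sum>t<n. w s t * of_bool (s = p) * of_bool (t = q)) = w p q"
    if "p < n" "q < n" for p q
    unfolding mult.assoc by (rule sum_mult_pick[OF that])
  have sq: "(\<Sum>s<n. (of_bool (s = p) :: real)\<^sup>2) = 1" if "p < n" for p
  proof -
    have "(of_bool b :: real)\<^sup>2 = 1 * of_bool b" for b by simp
    then show ?thesis by (simp only: sum_mult_of_bool_eq_single(2)[OF that])
  qed
  show "\<bar>w i j\<bar> \<le> 1" if "i < n" "j < n"
    using W[of "\<lambda>s. of_bool (s = i)" "\<lambda>t. of_bool (t = j)"] pick[OF that] sq that by simp
  show "\<bar>\<Sum>i<n. \<Sum>j<n. w i j\<bar> \<le> real n"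
    using W[of "\<lambda>_. 1" "\<lambda>_. 1"] by simp
  assume ij: "i < n" "j < n" "i \<noteq> j"
  let ?x = "\<lambda>s. of_bool (s = i) - of_bool (s = j) :: real"
  have "(\<Sum>s<n. \<Sum>t<n. w s t * ?x s * ?x t) =
     (\<Sum>s<n. \<Sum>t<n. w s t * of_bool (s = i) * of_bool (t = i)) + (\<Sum>s<n. \<Sum>t<n. w s t * of_bool (s = j) * of_bool (t = j))
     - (\<Sum>s<n. \<Sum>t<n. w s t * of_bool (s = i) * of_bool (t = j)) - (\<Sum>s<n. \<Sum>t<n. w s t * of_bool (s = j) * of_bool (t = i))"
    by (simp add: sum.distrib sum_subtractf ring_distribs)
  then have "(\<Sum>s<n. \<Sum>t<n. w s t * ?x s * ?x t) = w i i + w j j - w i j - w j i"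
    unfolding pick[OF ij(1,1)] pick[OF ij(2,2)] pick[OF ij(1,2)] pick[OF ij(2,1)] .
  moreover have "(\<Sum>s<n. (?x s)\<^sup>2) = (\<Sum>s<n. (of_bool (s = i) :: real)\<^sup>2 + (of_bool (s = j))\<^sup>2)"
    using ij by (intro sum.cong refl) auto
  ultimately show "\<bar>w i i + w j j - w i j - w j i\<bar> \<le> 2"
    using W[of ?x ?x] ij sq by (simp add: sum.distrib)
qed

subsection \<open>Independent Bernoulli variables\<close>

locale bernoulli_product =
  fixes I :: "'e set" and p :: real
  assumes fin: "finite I" and p_pos: "0 < p" and p_less: "p < 1"
begin

definition product_pmf :: "('e \<Rightarrow> bool) pmf" where
  "product_pmf = Pi_pmf I False (\<lambda>_. bernoulli_pmf p)"

definition expec :: "(('e \<Rightarrow> bool) \<Rightarrow> real) \<Rightarrow> real" where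
  "expec f = measure_pmf.expectation product_pmf f"

definition sigma2 :: real where "sigma2 = p * (1 - p)"

definition centred :: "('e \<Rightarrow> bool) \<Rightarrow> 'e \<Rightarrow> real" where
  "centred X e = of_bool (X e) - p"

text \<open>Independence from the coordinate \<open>e\<close>, encoded as invariance under updates
  so that simplification can establish it.\<close>

definition free_of :: "'e \<Rightarrow> (('e \<Rightarrow> bool) \<Rightarrow> real) \<Rightarrow> bool" where
  "free_of e g \<longleftrightarrow> (\<forall>X b. g (X(e := b)) = g X)"

lemma finite_set_product_pmf: "finite (set_pmf (Pi_pmf A False (\<lambda>_. bernoulli_pmf p)))" if "finite A"
  by (rule finite_subset[OF set_Pi_pmf_subset'[OF that]]) (intro finite_PiE_dflt that, simp)

lemma integrable_product_pmf [simp]: "integrable (measure_pmf product_pmf) (f :: _ \<Rightarrow> real)"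
  unfolding product_pmf_def by (intro integrable_measure_pmf_finite finite_set_product_pmf fin)

lemma expec_add: "expec (\<lambda>X. f X + g X) = expec f + expec g"
  and expec_diff: "expec (\<lambda>X. f X - g X) = expec f - expec g"
  and expec_cmult: "expec (\<lambda>X. c * f X) = c * expec f"
  and expec_const: "expec (\<lambda>X. c) = c"
  and expec_sum: "expec (\<lambda>X. \<Sum>t\<in>T. F t X) = (\<Sum>t\<in>T. expec (F t))"
  unfolding expec_def by simp_all

lemma expec_mono: "(\<And>X. f X \<le> g X) \<Longrightarrow> expec f \<le> expec g"
  unfolding expec_def by (intro integral_mono) auto

lemma sigma2_pos: "0 < sigma2" and sigma2_le: "sigma2 \<le> 1"
  using p_pos p_less by (auto simp: sigma2_def intro: mult_le_one)

lemma abs_centred_le: "\<bar>centred X e\<bar> \<le> 1"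
  using p_pos p_less by (auto simp: centred_def of_bool_def)

text \<open>Conditioning on the coordinate \<open>e\<close>. Both the factorization of expectations
  and the variance bound rest on it.\<close>

lemma expectation_Pi_insert:
  fixes F :: "_ \<Rightarrow> real"
  assumes "finite A" "e \<notin> A"
  shows "measure_pmf.expectation (Pi_pmf (insert e A) False (\<lambda>_. bernoulli_pmf p)) F =
    p * measure_pmf.expectation (Pi_pmf A False (\<lambda>_. bernoulli_pmf p)) (\<lambda>X. F (X(e := True))) +
    (1 - p) * measure_pmf.expectation (Pi_pmf A False (\<lambda>_. bernoulli_pmf p)) (\<lambda>X. F (X(e := False)))"
proof -
  have eq: "Pi_pmf (insert e A) False (\<lambda>_. bernoulli_pmf p) =
    bind_pmf (bernoulli_pmf p) (\<lambda>y. map_pmf (\<lambda>f. f(e := y)) (Pi_pmf A False (\<lambda>_. bernoulli_pmf p)))"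
    unfolding Pi_pmf_insert'[OF assms] by (simp add: map_pmf_def)
  show ?thesis
    unfolding eq
    apply (subst pmf_expectation_bind[of "UNIV :: bool set"])
    using p_pos p_less finite_set_product_pmf[OF assms(1)] by (auto simp: UNIV_bool)
qed

lemma expec_split:
  assumes "e \<in> I"
  shows "expec (\<lambda>X. h (X e) * g (X(e := False))) =
    (p * h True + (1 - p) * h False) * expec (\<lambda>X. g (X(e := False)))"
proof -
  have I: "I = insert e (I - {e})" and A: "finite (I - {e})" "e \<notin> I - {e}" using assms fin by auto
  show ?thesis
    unfolding expec_def product_pmf_def by (subst (1 2) I, subst (1 2) expectation_Pi_insert[OF A]) (simp add: algebra_simps)
qed

lemma expec_indep:
  assumes "e \<in> I" "free_of e g"
  shows "expec (\<lambda>X. h (X e) * g X) = (p * h True + (1 - p) * h False) * expec g"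
  using expec_split[OF assms(1), of h g] assms(2) by (simp add: free_of_def)

lemma expec_centred: "e \<in> I \<Longrightarrow> free_of e g \<Longrightarrow> expec (\<lambda>X. centred X e * g X) = 0"
  unfolding centred_def by (subst expec_indep) (auto simp: algebra_simps)

lemma expec_centred2: "e \<in> I \<Longrightarrow> free_of e g \<Longrightarrow> expec (\<lambda>X. (centred X e)\<^sup>2 * g X) = sigma2 * expec g"
  unfolding centred_def by (subst expec_indep[where h = "\<lambda>b. (of_bool b - p)\<^sup>2"])
    (auto simp: algebra_simps power2_eq_square sigma2_def)

text \<open>The third moment of a centred Bernoulli variable vanishes only for
  \<open>p = 1/2\<close>, so the mean of the other factor has to vanish instead.\<close>

lemma expec_centred_odd3: "e \<in> I \<Longrightarrow> free_of e g \<Longrightarrow> expec g = 0 \<Longrightarrow> expec (\<lambda>X. centred X e ^ 3 * g X) = 0"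
  unfolding centred_def by (subst expec_indep[where h = "\<lambda>b. (of_bool b - p) ^ 3"]) auto

lemma expec_centred4_le: "expec (\<lambda>X. centred X e ^ 4) \<le> 1"
proof -
  have "centred X e ^ 4 \<le> 1" for X
    using power_le_one[OF abs_ge_zero abs_centred_le, of X e 4] by (simp add: power_even_abs)
  then have "expec (\<lambda>X. centred X e ^ 4) \<le> expec (\<lambda>X. 1)" by (rule expec_mono)
  then show ?thesis by (simp add: expec_const)
qed

lemma expec_square_ge: "(expec f)\<^sup>2 \<le> expec (\<lambda>X. (f X)\<^sup>2)"
proof -
  have "0 \<le> expec (\<lambda>X. (f X - expec f)\<^sup>2)" unfolding expec_def by (intro Bochner_Integration.integral_nonneg) auto
  also have "\<dots> = expec (\<lambda>X. (f X)\<^sup>2 + (expec f)\<^sup>2 - 2 * expec f * f X)"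
    by (simp add: power2_diff algebra_simps)
  also have "\<dots> = expec (\<lambda>X. (f X)\<^sup>2) - (expec f)\<^sup>2"
    by (simp add: expec_add expec_diff expec_const expec_cmult power2_eq_square)
  finally show ?thesis by simp
qed

lemma expec_sum_square:
  assumes "\<And>s t. s \<in> T \<Longrightarrow> t \<in> T \<Longrightarrow> s \<noteq> t \<Longrightarrow> expec (\<lambda>X. m s X * m t X) = 0" "finite T"
  shows "expec (\<lambda>X. (\<Sum>t\<in>T. m t X)\<^sup>2) = (\<Sum>t\<in>T. expec (\<lambda>X. (m t X)\<^sup>2))"
proof -
  have "expec (\<lambda>X. (\<Sum>t\<in>T. m t X)\<^sup>2) = (\<Sum>s\<in>T. \<Sum>t\<in>T. expec (\<lambda>X. m s X * m t X))"
    by (simp add: power2_eq_square sum_product expec_sum)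
  also have "\<dots> = (\<Sum>s\<in>T. \<Sum>t\<in>T. if s = t then expec (\<lambda>X. (m s X)\<^sup>2) else 0)"
    using assms by (intro sum.cong refl) (auto simp: power2_eq_square)
  also have "\<dots> = (\<Sum>t\<in>T. expec (\<lambda>X. (m t X)\<^sup>2))" using assms(2) by simp
  finally show ?thesis .
qed

lemma free_of_sum: "(\<And>t. t \<in> T \<Longrightarrow> free_of e (F t)) \<Longrightarrow> free_of e (\<lambda>X. \<Sum>t\<in>T. F t X)"
  unfolding free_of_def by (auto intro!: sum.cong)

lemma free_of_centred: "e \<noteq> e' \<Longrightarrow> free_of e (\<lambda>X. centred X e')"
  unfolding free_of_def centred_def by auto

section \<open>Linear and quadratic sums of centred variables\<close>

text \<open>On the edges at a vertex, \<open>lin\<close> is the centred degree and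
  \<open>quad\<close> is the diagonal entry of the squared adjacency matrix.\<close>

definition lin :: "'e set \<Rightarrow> ('e \<Rightarrow> bool) \<Rightarrow> real" where "lin J X = (\<Sum>e\<in>J. centred X e)"
definition quad :: "'e set \<Rightarrow> ('e \<Rightarrow> bool) \<Rightarrow> real" where "quad J X = (\<Sum>e\<in>J. (centred X e)\<^sup>2)"

lemma lin_quad_insert:
  assumes "finite J" "e \<notin> J"
  shows "lin (insert e J) X = centred X e + lin J X" "quad (insert e J) X = (centred X e)\<^sup>2 + quad J X"
  using assms by (auto simp: lin_def quad_def)

lemma free_of_lin_quad: "e \<notin> J \<Longrightarrow> free_of e (lin J)" "e \<notin> J \<Longrightarrow> free_of e (quad J)"
  unfolding free_of_def lin_def quad_def centred_def by (auto intro!: sum.cong)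

lemma expec_lin: "J \<subseteq> I \<Longrightarrow> expec (lin J) = 0"
proof -
  assume J: "J \<subseteq> I"
  have "expec (\<lambda>X. centred X e) = 0" if "e \<in> J" for e
    using expec_centred[of e "\<lambda>_. 1"] that J by (auto simp: free_of_def)
  then show ?thesis by (simp add: lin_def[abs_def] expec_sum)
qed

lemma expec_quad: "J \<subseteq> I \<Longrightarrow> expec (quad J) = card J * sigma2"
proof -
  assume J: "J \<subseteq> I"
  have "expec (\<lambda>X. (centred X e)\<^sup>2) = sigma2" if "e \<in> J" for e
    using expec_centred2[of e "\<lambda>_. 1"] that J by (auto simp: free_of_def expec_const)
  then show ?thesis by (simp add: quad_def[abs_def] expec_sum)
qed

lemma expec_lin_square:
  assumes J: "J \<subseteq> I"
  shows "expec (\<lambda>X. (lin J X)\<^sup>2) = card J * sigma2"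
proof -
  have "expec (\<lambda>X. (lin J X)\<^sup>2) = (\<Sum>e\<in>J. expec (\<lambda>X. (centred X e)\<^sup>2))"
    unfolding lin_def
    by (rule expec_sum_square) (use J fin in \<open>auto intro!: expec_centred free_of_centred intro: finite_subset\<close>)
  also have "\<dots> = expec (quad J)" by (simp add: quad_def[abs_def] expec_sum)
  finally show ?thesis using expec_quad[OF J] by simp
qed

text \<open>Edges are added one at a time, each independent of the sum so far. Bounding fourth
  moments by 1 costs only a term linear in \<open>card J\<close>.\<close>

lemma expec_quad_square_le:
  assumes J: "J \<subseteq> I"
  shows "expec (\<lambda>X. (quad J X)\<^sup>2) \<le> (card J)\<^sup>2 * sigma2\<^sup>2 + card J"
proof -
  have "finite J" using J fin by (rule finite_subset)
  then show ?thesis using J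
  proof (induction J rule: finite_induct)
    case empty
    then show ?case by (simp add: quad_def[abs_def] expec_const)
  next
    case (insert e J)
    have e: "e \<in> I" "J \<subseteq> I" using insert.prems by auto
    have "expec (\<lambda>X. (quad (insert e J) X)\<^sup>2) =
        expec (\<lambda>X. (quad J X)\<^sup>2 + (2 * ((centred X e)\<^sup>2 * quad J X) + centred X e ^ 4))"
      by (simp add: lin_quad_insert[OF insert.hyps] power2_eq_square numeral_eq_Suc algebra_simps)
    also have "\<dots> = expec (\<lambda>X. (quad J X)\<^sup>2) + (2 * (sigma2 * (card J * sigma2)) + expec (\<lambda>X. centred X e ^ 4))"
      unfolding expec_add expec_cmult
      using expec_centred2[OF e(1) free_of_lin_quad(2)[OF insert.hyps(2)]] expec_quad[OF e(2)] by simp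
    also have "\<dots> \<le> ((card J)\<^sup>2 * sigma2\<^sup>2 + card J) + (2 * (sigma2 * (card J * sigma2)) + 1)"
      using insert.IH[OF e(2)] expec_centred4_le[of e] by simp
    also have "\<dots> \<le> (card (insert e J))\<^sup>2 * sigma2\<^sup>2 + card (insert e J)"
      using insert.hyps by (simp add: power2_eq_square algebra_simps)
    finally show ?case .
  qed
qed

text \<open>This serves the diagonal entries of the squared Laplacian. The leading constant is 6 = 3
  + 2 + 1: the Gaussian fourth moment of \<open>lin\<close>, the mixed term, and the square of the
  mean of \<open>quad\<close>.\<close>

lemma expec_lin2_quad_square_le:
  assumes J: "J \<subseteq> I"
  shows "expec (\<lambda>X. ((lin J X)\<^sup>2 + quad J X)\<^sup>2) \<le> 6 * (card J)\<^sup>2 * sigma2\<^sup>2 + 4 * card J"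
proof -
  have "finite J" using J fin by (rule finite_subset)
  then show ?thesis using J
  proof (induction J rule: finite_induct)
    case empty
    then show ?case by (simp add: quad_def[abs_def] lin_def[abs_def] expec_const)
  next
    case (insert e J)
    have e: "e \<in> I" "J \<subseteq> I" using insert.prems by auto
    define T where "T X = (lin J X)\<^sup>2 + quad J X" for X
    note free = free_of_lin_quad[OF insert.hyps(2)]
    have fT: "free_of e (\<lambda>X. T X * lin J X)" "free_of e T" "free_of e (\<lambda>X. (lin J X)\<^sup>2)"
      using free by (auto simp: free_of_def T_def)
    \<comment> \<open>With \<open>x = centred X e\<close>, adding \<open>e\<close> turns
      \<open>T\<close> into \<open>T + 2 * x * lin J + 2 * x^2\<close>; this is its expanded
      square.\<close>
    have "expec (\<lambda>X. ((lin (insert e J) X)\<^sup>2 + quad (insert e J) X)\<^sup>2) =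
        expec (\<lambda>X. (T X)\<^sup>2 + (4 * (centred X e * (T X * lin J X)) + (4 * ((centred X e)\<^sup>2 * T X) +
          (4 * ((centred X e)\<^sup>2 * (lin J X)\<^sup>2) + (8 * (centred X e ^ 3 * lin J X) + 4 * centred X e ^ 4)))))"
      by (rule arg_cong[of _ _ expec])
        (simp add: fun_eq_iff lin_quad_insert[OF insert.hyps] T_def power2_eq_square numeral_eq_Suc algebra_simps)
    also have "\<dots> = expec (\<lambda>X. (T X)\<^sup>2) + (4 * 0 + (4 * (sigma2 * (2 * (card J * sigma2))) +
          (4 * (sigma2 * (card J * sigma2)) + (8 * 0 + 4 * expec (\<lambda>X. centred X e ^ 4)))))"
    proof -
      have "expec T = 2 * (card J * sigma2)"
        unfolding T_def expec_add expec_lin_square[OF e(2)] expec_quad[OF e(2)] by simp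
      then show ?thesis
        unfolding expec_add expec_cmult expec_centred[OF e(1) fT(1)] expec_centred2[OF e(1) fT(2)] expec_centred2[OF e(1) fT(3)]
          expec_centred_odd3[OF e(1) free(1) expec_lin[OF e(2)]] expec_lin_square[OF e(2)] by simp
    qed
    also have "\<dots> \<le> (6 * (card J)\<^sup>2 * sigma2\<^sup>2 + 4 * card J) + (4 * 0 + (4 * (sigma2 * (2 * (card J * sigma2))) +
          (4 * (sigma2 * (card J * sigma2)) + (8 * 0 + 4 * 1))))"
      using insert.IH[OF e(2)] expec_centred4_le[of e] unfolding T_def by simp
    also have "\<dots> \<le> 6 * (card (insert e J))\<^sup>2 * sigma2\<^sup>2 + 4 * card (insert e J)"
      using insert.hyps by (simp add: power2_eq_square algebra_simps)
    finally show ?case .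
  qed
qed

section \<open>Variance and deviation under bounded differences\<close>

text \<open>An Efron-Stein type bound on the variance. Conditioning on one coordinate leaves two
  functions to which the induction hypothesis applies, and their means differ by at most
  \<open>c\<close>.\<close>

lemma expectation_square_le_bounded_differences:
  fixes c :: real
  assumes "finite A" and "\<And>X e. e \<in> A \<Longrightarrow> \<bar>f (X(e := True)) - f (X(e := False))\<bar> \<le> c"
  shows "measure_pmf.expectation (Pi_pmf A False (\<lambda>_. bernoulli_pmf p)) (\<lambda>X. (f X)\<^sup>2) \<le>
    (measure_pmf.expectation (Pi_pmf A False (\<lambda>_. bernoulli_pmf p)) f)\<^sup>2 + c\<^sup>2 * card A"
  using assms
proof (induction A arbitrary: f rule: finite_induct)
  case empty
  then show ?case by simp
next
  case (insert e A)
  let ?E = "measure_pmf.expectation (Pi_pmf A False (\<lambda>_. bernoulli_pmf p))"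
  let ?f = "\<lambda>b X. f (X(e := b))"
  have int: "integrable (measure_pmf (Pi_pmf A False (\<lambda>_. bernoulli_pmf p))) (g :: _ \<Rightarrow> real)" for g
    using insert.hyps by (intro integrable_measure_pmf_finite finite_set_product_pmf)
  have IH: "?E (\<lambda>X. (?f b X)\<^sup>2) \<le> (?E (?f b))\<^sup>2 + c\<^sup>2 * card A" for b
  proof (rule insert.IH)
    fix X e' assume e': "e' \<in> A"
    then have "e \<noteq> e'" using insert.hyps by auto
    then have twist: "X(e' := d, e := b) = X(e := b, e' := d)" for d by (rule fun_upd_twist[symmetric])
    show "\<bar>?f b (X(e' := True)) - ?f b (X(e' := False))\<bar> \<le> c"
      unfolding twist by (rule insert.prems) (simp add: e')
  qed
  have "\<bar>?E (?f True) - ?E (?f False)\<bar> = \<bar>?E (\<lambda>X. ?f True X - ?f False X)\<bar>"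
    using int by simp
  also have "\<dots> \<le> ?E (\<lambda>X. \<bar>?f True X - ?f False X\<bar>)" by (rule integral_abs_bound)
  also have "\<dots> \<le> ?E (\<lambda>X. c)" by (rule integral_mono[OF int int], rule insert.prems) simp
  finally have d: "\<bar>?E (?f True) - ?E (?f False)\<bar> \<le> c" by simp
  define u v where "u = ?E (?f True)" and "v = ?E (?f False)"
  have "p * (1 - p) * (u - v)\<^sup>2 \<le> (u - v)\<^sup>2"
    using sigma2_pos sigma2_le by (intro mult_left_le_one_le) (auto simp: sigma2_def)
  also have "\<dots> \<le> c\<^sup>2"
    using power_mono[OF d abs_ge_zero, of 2] by (simp add: u_def v_def)
  finally have uv: "p * (1 - p) * (u - v)\<^sup>2 \<le> c\<^sup>2" .
  have "p * ?E (\<lambda>X. (?f True X)\<^sup>2) + (1 - p) * ?E (\<lambda>X. (?f False X)\<^sup>2) \<le>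
      p * (u\<^sup>2 + c\<^sup>2 * card A) + (1 - p) * (v\<^sup>2 + c\<^sup>2 * card A)"
    unfolding u_def v_def using IH[of True] IH[of False] p_pos p_less by (intro add_mono mult_left_mono) auto
  \<comment> \<open>Mean square of the two-point mixture of \<open>u\<close> and \<open>v\<close> as
    squared mean plus variance.\<close>
  also have "\<dots> = (p * u + (1 - p) * v)\<^sup>2 + p * (1 - p) * (u - v)\<^sup>2 + c\<^sup>2 * card A"
    by (simp add: power2_eq_square algebra_simps)
  also have "\<dots> \<le> (p * u + (1 - p) * v)\<^sup>2 + c\<^sup>2 * card (insert e A)"
    using uv insert.hyps by (simp add: algebra_simps)
  finally show ?case
    unfolding expectation_Pi_insert[OF insert.hyps] u_def v_def .
qed

text \<open>Chebyshev at distance \<open>expec f - t\<close> below the mean, with the variance bound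
  just obtained.\<close>

lemma prob_le_bounded_differences:
  fixes c t :: real
  assumes lip: "\<And>X e. e \<in> I \<Longrightarrow> \<bar>f (X(e := True)) - f (X(e := False))\<bar> \<le> c" and t: "t < expec f"
  shows "measure_pmf.prob product_pmf {X. f X \<le> t} \<le> c\<^sup>2 * card I / (expec f - t)\<^sup>2"
proof -
  let ?d = "expec f - t"
  have "?d\<^sup>2 * measure_pmf.prob product_pmf {X. f X \<le> t} = expec (\<lambda>X. ?d\<^sup>2 * indicator {X. f X \<le> t} X)"
    by (simp add: expec_cmult) (simp add: expec_def)
  also have "\<dots> \<le> expec (\<lambda>X. (f X - expec f)\<^sup>2)"
  proof (rule expec_mono)
    fix X
    show "?d\<^sup>2 * indicator {X. f X \<le> t} X \<le> (f X - expec f)\<^sup>2"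
    proof (cases "f X \<le> t")
      case True
      then have "?d\<^sup>2 \<le> (expec f - f X)\<^sup>2" using t by (intro power_mono) auto
      then show ?thesis using True by (simp add: power2_commute)
    qed simp
  qed
  also have "\<dots> = expec (\<lambda>X. (f X)\<^sup>2 + (expec f)\<^sup>2 - 2 * expec f * f X)"
    by (simp add: power2_diff algebra_simps)
  also have "\<dots> = expec (\<lambda>X. (f X)\<^sup>2) - (expec f)\<^sup>2"
    by (simp add: expec_add expec_diff expec_const expec_cmult power2_eq_square)
  also have "\<dots> \<le> c\<^sup>2 * card I"
    using expectation_square_le_bounded_differences[OF fin lip] by (simp add: expec_def product_pmf_def)
  finally show ?thesis using t by (simp add: field_simps)
qed

end

subsection \<open>Moments of the centred adjacency and Laplacian matrices\<close>

lemma finite_all_edges: "finite (all_edges n)"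
  unfolding all_edges_def by (rule finite_subset[of _ "Pow {1..n}"]) auto

locale random_graph =
  fixes n :: nat and p :: real
  assumes p01: "0 < p" "p < 1"
begin

sublocale bernoulli_product "all_edges n" p
  by unfold_locales (use p01 finite_all_edges in auto)

definition vertex_edge :: "nat \<Rightarrow> nat \<Rightarrow> nat set" where "vertex_edge i j = {Suc i, Suc j}"

definition adj :: "(nat set \<Rightarrow> bool) \<Rightarrow> nat \<Rightarrow> nat \<Rightarrow> real" where
  "adj X i j = (if i = j then 0 else centred X (vertex_edge i j))"

definition deg :: "(nat set \<Rightarrow> bool) \<Rightarrow> nat \<Rightarrow> real" where "deg X i = (\<Sum>j<n. adj X i j)"

definition lap :: "(nat set \<Rightarrow> bool) \<Rightarrow> nat \<Rightarrow> nat \<Rightarrow> real" where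
  "lap X i j = of_bool (i = j) * deg X i - adj X i j"

definition walk2 :: "(nat set \<Rightarrow> bool) \<Rightarrow> nat \<Rightarrow> nat \<Rightarrow> real" where
  "walk2 X = array_mult n (adj X) (adj X)"

definition walk3 :: "(nat set \<Rightarrow> bool) \<Rightarrow> nat \<Rightarrow> nat \<Rightarrow> real" where
  "walk3 X = array_mult n (array_mult n (adj X) (adj X)) (adj X)"

definition sqdeg :: "(nat set \<Rightarrow> bool) \<Rightarrow> nat \<Rightarrow> real" where "sqdeg X i = (\<Sum>j<n. (adj X i j)\<^sup>2)"

definition star :: "nat \<Rightarrow> nat set set" where "star i = vertex_edge i ` ({..<n} - {i})"

definition rest :: "nat \<Rightarrow> nat \<Rightarrow> nat set" where "rest i j = {..<n} - {i, j}"

text \<open>The edge between \<open>i\<close> and \<open>j\<close> itself is left out, so that sums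
  over this set are independent of \<open>adj X i j\<close>.\<close>

definition double_star :: "nat \<Rightarrow> nat \<Rightarrow> nat set set" where
  "double_star i j = vertex_edge i ` rest i j \<union> vertex_edge j ` rest i j"

lemma vertex_edge_eq_iff: "vertex_edge i j = vertex_edge k l \<longleftrightarrow> (i = k \<and> j = l) \<or> (i = l \<and> j = k)"
  by (auto simp: vertex_edge_def doubleton_eq_iff)

lemma vertex_edge_in: "i < n \<Longrightarrow> j < n \<Longrightarrow> i \<noteq> j \<Longrightarrow> vertex_edge i j \<in> all_edges n"
  by (auto simp: vertex_edge_def all_edges_def)

lemma adj_sym: "adj X i j = adj X j i"
  by (auto simp: adj_def vertex_edge_def insert_commute)

lemma adj_diag [simp]: "adj X i i = 0" by (simp add: adj_def)

lemma abs_adj_le: "\<bar>adj X i j\<bar> \<le> 1" by (simp add: adj_def abs_centred_le)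

lemma adj_upd: "vertex_edge i j \<noteq> vertex_edge k l \<Longrightarrow> adj (X(vertex_edge i j := b)) k l = adj X k l"
  by (auto simp: adj_def centred_def)

lemma expec_adj:
  assumes "i < n" "j < n" "i \<noteq> j" "free_of (vertex_edge i j) g"
  shows "expec (\<lambda>X. adj X i j * g X) = 0"
  using expec_centred[OF vertex_edge_in[OF assms(1-3)] assms(4)] assms(3) by (simp add: adj_def)

lemma expec_adj2:
  assumes "i < n" "j < n" "i \<noteq> j" "free_of (vertex_edge i j) g"
  shows "expec (\<lambda>X. (adj X i j)\<^sup>2 * g X) = sigma2 * expec g"
  using expec_centred2[OF vertex_edge_in[OF assms(1-3)] assms(4)] assms(3) by (simp add: adj_def)

lemma expec_adj_odd3:
  assumes "i < n" "j < n" "i \<noteq> j" "free_of (vertex_edge i j) g" "expec g = 0"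
  shows "expec (\<lambda>X. adj X i j ^ 3 * g X) = 0"
  using expec_centred_odd3[OF vertex_edge_in[OF assms(1-3)] assms(4,5)] assms(3) by (simp add: adj_def)

lemma sum_star: "(\<Sum>e\<in>star i. f e) = (\<Sum>j\<in>{..<n} - {i}. f (vertex_edge i j))"
  unfolding star_def by (subst sum.reindex) (auto simp: inj_on_def vertex_edge_eq_iff)

lemma deg_eq_lin: "i < n \<Longrightarrow> deg X i = lin (star i) X"
  unfolding deg_def lin_def sum_star
  by (subst sum.remove[of _ i]) (auto simp: adj_def intro!: sum.cong)

lemma sqdeg_eq_quad: "i < n \<Longrightarrow> sqdeg X i = quad (star i) X"
  unfolding sqdeg_def quad_def sum_star
  by (subst sum.remove[of _ i]) (auto simp: adj_def intro!: sum.cong)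

lemma card_star: "i < n \<Longrightarrow> card (star i) = n - 1"
  unfolding star_def by (subst card_image) (auto simp: inj_on_def vertex_edge_eq_iff)

lemma star_subset: "i < n \<Longrightarrow> star i \<subseteq> all_edges n"
  by (auto simp: star_def intro!: vertex_edge_in)

lemma finite_rest: "finite (rest i j)" by (simp add: rest_def)

lemma card_rest: "i < n \<Longrightarrow> j < n \<Longrightarrow> i \<noteq> j \<Longrightarrow> card (rest i j) = n - 2"
  unfolding rest_def by (subst card_Diff_subset) auto

lemma sum_split_rest:
  fixes f :: "nat \<Rightarrow> real"
  assumes "i < n" "j < n" "i \<noteq> j"
  shows "(\<Sum>k<n. f k) = f i + f j + (\<Sum>k\<in>rest i j. f k)"
proof -
  have "(\<Sum>k<n. f k) = f i + (f j + (\<Sum>k\<in>{..<n} - {i} - {j}. f k))"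
    using assms by (simp add: sum.remove[of "{..<n}" i] sum.remove[of "{..<n} - {i}" j])
  also have "{..<n} - {i} - {j} = rest i j" by (auto simp: rest_def)
  finally show ?thesis by simp
qed

lemma sum_double_star:
  fixes f :: "nat set \<Rightarrow> real"
  assumes "i \<noteq> j"
  shows "(\<Sum>e\<in>double_star i j. f e) = (\<Sum>k\<in>rest i j. f (vertex_edge i k)) + (\<Sum>k\<in>rest i j. f (vertex_edge j k))"
  unfolding double_star_def
  using assms by (subst sum.union_disjoint)
    (auto simp: finite_rest sum.reindex inj_on_def vertex_edge_eq_iff, auto simp: rest_def)

lemma card_double_star:
  assumes "i < n" "j < n" "i \<noteq> j"
  shows "real (card (double_star i j)) = 2 * (real n - 2)"
proof -
  have "real (card (double_star i j)) = (\<Sum>e\<in>double_star i j. 1)" by simp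
  also have "\<dots> = 2 * real (n - 2)"
    unfolding sum_double_star[OF assms(3)] using card_rest[OF assms] by simp
  finally show ?thesis using assms by (simp add: of_nat_diff)
qed

lemma double_star_subset: "i < n \<Longrightarrow> j < n \<Longrightarrow> double_star i j \<subseteq> all_edges n"
  by (auto simp: double_star_def rest_def intro!: vertex_edge_in)

lemma vertex_edge_notin_double_star: "i \<noteq> j \<Longrightarrow> vertex_edge i j \<notin> double_star i j"
  by (auto simp: double_star_def rest_def vertex_edge_eq_iff)

lemma lin_double_star:
  "i \<noteq> j \<Longrightarrow> lin (double_star i j) X = (\<Sum>k\<in>rest i j. adj X i k) + (\<Sum>k\<in>rest i j. adj X j k)"
  unfolding lin_def by (subst sum_double_star) (auto simp: adj_def rest_def intro!: arg_cong2[of _ _ _ _ "(+)"] sum.cong)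

lemma quad_double_star:
  "i \<noteq> j \<Longrightarrow> quad (double_star i j) X = (\<Sum>k\<in>rest i j. (adj X i k)\<^sup>2) + (\<Sum>k\<in>rest i j. (adj X j k)\<^sup>2)"
  unfolding quad_def by (subst sum_double_star) (auto simp: adj_def rest_def intro!: arg_cong2[of _ _ _ _ "(+)"] sum.cong)

lemma expec_deg_square: "i < n \<Longrightarrow> expec (\<lambda>X. (deg X i)\<^sup>2) = (real n - 1) * sigma2"
  by (simp add: deg_eq_lin expec_lin_square star_subset card_star of_nat_diff)

lemma expec_sqdeg: "i < n \<Longrightarrow> expec (\<lambda>X. sqdeg X i) = (real n - 1) * sigma2"
  by (simp add: sqdeg_eq_quad expec_quad star_subset card_star of_nat_diff)

lemma expec_frobenius_sq_adj: "expec (\<lambda>X. frobenius_sq n (adj X)) = real n * ((real n - 1) * sigma2)"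
  by (simp add: frobenius_sq_def expec_sum expec_sqdeg flip: sqdeg_def)

text \<open>Degrees sit on the diagonal and \<open>adj\<close> off it, so no cross terms arise. Both
  contribute equally, which gives the factor 2.\<close>

lemma expec_frobenius_sq_lap: "expec (\<lambda>X. frobenius_sq n (lap X)) = 2 * (real n * ((real n - 1) * sigma2))"
proof -
  have sq: "(lap X i j)\<^sup>2 = (deg X i)\<^sup>2 * of_bool (i = j) + (adj X i j)\<^sup>2" for X i j
    by (auto simp: lap_def)
  have "frobenius_sq n (lap X) = (\<Sum>i<n. (deg X i)\<^sup>2 + sqdeg X i)" for X
    unfolding frobenius_sq_def sqdeg_def
  proof (rule sum.cong[OF refl])
    fix i assume "i \<in> {..<n}"
    then show "(\<Sum>j<n. (lap X i j)\<^sup>2) = (deg X i)\<^sup>2 + (\<Sum>j<n. (adj X i j)\<^sup>2)"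
      unfolding sq sum.distrib by (subst sum_mult_of_bool_eq_single) auto
  qed
  then show ?thesis by (simp add: expec_sum expec_add expec_deg_square expec_sqdeg)
qed

section \<open>Walks of length two\<close>

lemma walk2_diag: "walk2 X i i = sqdeg X i"
  unfolding walk2_def array_mult_def sqdeg_def by (simp add: power2_eq_square adj_sym)

lemma walk2_off_diag:
  assumes "i < n" "j < n" "i \<noteq> j"
  shows "walk2 X i j = (\<Sum>k\<in>rest i j. adj X i k * adj X k j)"
  unfolding walk2_def array_mult_def sum_split_rest[OF assms] by simp

text \<open>A walk from \<open>i\<close> to \<open>j\<close> through a third vertex avoids the edge
  between \<open>i\<close> and \<open>j\<close>.\<close>

lemma free_of_walk2:
  assumes "i < n" "j < n" "i \<noteq> j"
  shows "free_of (vertex_edge i j) (\<lambda>X. walk2 X i j)"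
  unfolding walk2_off_diag[OF assms]
  by (intro free_of_sum) (auto simp: free_of_def rest_def adj_upd vertex_edge_eq_iff)

lemma expec_walk2:
  assumes "i < n" "j < n" "i \<noteq> j"
  shows "expec (\<lambda>X. walk2 X i j) = 0"
  unfolding walk2_off_diag[OF assms] expec_sum
proof (rule sum.neutral, rule ballI)
  fix k assume "k \<in> rest i j"
  then show "expec (\<lambda>X. adj X i k * adj X k j) = 0"
    using assms by (intro expec_adj) (auto simp: free_of_def rest_def adj_upd vertex_edge_eq_iff)
qed

text \<open>Different midpoints give orthogonal products, and there are \<open>n - 2\<close>
  midpoints.\<close>

lemma expec_walk2_square:
  assumes "i < n" "j < n" "i \<noteq> j"
  shows "expec (\<lambda>X. (walk2 X i j)\<^sup>2) = (real n - 2) * sigma2\<^sup>2"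
proof -
  have "expec (\<lambda>X. (walk2 X i j)\<^sup>2) = (\<Sum>k\<in>rest i j. expec (\<lambda>X. (adj X i k * adj X k j)\<^sup>2))"
    unfolding walk2_off_diag[OF assms]
  proof (rule expec_sum_square)
    fix k l assume kl: "k \<in> rest i j" "l \<in> rest i j" "k \<noteq> l"
    \<comment> \<open>The edge between \<open>i\<close> and \<open>k\<close> occurs once in this
      product, so averaging over it gives 0.\<close>
    have "expec (\<lambda>X. adj X i k * (adj X k j * (adj X i l * adj X l j))) = 0"
      using assms kl by (intro expec_adj) (auto simp: free_of_def rest_def adj_upd vertex_edge_eq_iff)
    then show "expec (\<lambda>X. adj X i k * adj X k j * (adj X i l * adj X l j)) = 0" by (simp add: mult.assoc)
  qed (rule finite_rest)
  also have "\<dots> = (\<Sum>k\<in>rest i j. sigma2\<^sup>2)"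
  proof (rule sum.cong[OF refl])
    fix k assume k: "k \<in> rest i j"
    have "expec (\<lambda>X. (adj X i k)\<^sup>2 * ((adj X k j)\<^sup>2 * 1)) = sigma2 * (sigma2 * expec (\<lambda>_. 1))"
      using assms k by (subst expec_adj2, (auto simp: free_of_def rest_def adj_upd vertex_edge_eq_iff)[4], subst expec_adj2)
        (auto simp: free_of_def rest_def)
    then show "expec (\<lambda>X. (adj X i k * adj X k j)\<^sup>2) = sigma2\<^sup>2"
      by (simp add: expec_const power_mult_distrib power2_eq_square[of sigma2])
  qed
  finally show ?thesis using assms by (simp add: card_rest of_nat_diff)
qed

text \<open>A lower bound is needed, as the fourth moment enters the sextic estimate with a negative
  sign. Jensen handles the diagonal. Diagonal and off-diagonal entries each contribute one leading
  term, giving the Catalan number 2.\<close>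

lemma expec_frobenius_sq_walk2_ge:
  "expec (\<lambda>X. frobenius_sq n (walk2 X)) \<ge> 2 * real n ^ 3 * sigma2\<^sup>2 - 5 * (real n)\<^sup>2"
proof -
  let ?N = "real n"
  have "expec (\<lambda>X. (walk2 X i j)\<^sup>2) \<ge> (?N - 2) * sigma2\<^sup>2 + of_bool (i = j) * (((?N - 1) * sigma2)\<^sup>2 - (?N - 2) * sigma2\<^sup>2)"
    if "i < n" "j < n" for i j
    using that expec_walk2_square[OF that] expec_square_ge[of "\<lambda>X. walk2 X i j"] expec_sqdeg[of i] 
    by (cases "i = j") (auto simp: walk2_diag)
  then have "expec (\<lambda>X. frobenius_sq n (walk2 X)) \<ge>
     (\<Sum>i<n. \<Sum>j<n. (?N - 2) * sigma2\<^sup>2 + (((?N - 1) * sigma2)\<^sup>2 - (?N - 2) * sigma2\<^sup>2) * of_bool (i = j))"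
    unfolding frobenius_sq_def expec_sum by (intro sum_mono) (auto simp: mult.commute)
  also have "(\<Sum>i<n. \<Sum>j<n. (?N - 2) * sigma2\<^sup>2 + (((?N - 1) * sigma2)\<^sup>2 - (?N - 2) * sigma2\<^sup>2) * of_bool (i = j)) =
     ?N * (?N * ((?N - 2) * sigma2\<^sup>2) + (((?N - 1) * sigma2)\<^sup>2 - (?N - 2) * sigma2\<^sup>2))"
    by (simp add: sum.distrib sum_mult_of_bool_eq_single del: sum_mult_of_bool_eq)
  also have "\<dots> = 2 * ?N ^ 3 * sigma2\<^sup>2 - 5 * (?N\<^sup>2 * sigma2\<^sup>2) + 3 * (?N * sigma2\<^sup>2)"
    by (simp add: power2_eq_square power3_eq_cube algebra_simps)
  also have "\<dots> \<ge> 2 * ?N ^ 3 * sigma2\<^sup>2 - 5 * ?N\<^sup>2"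
  proof -
    have "sigma2\<^sup>2 \<le> 1" using sigma2_pos sigma2_le by (simp add: power_le_one)
    then have "?N\<^sup>2 * sigma2\<^sup>2 \<le> ?N\<^sup>2 * 1" by (intro mult_left_mono) auto
    moreover have "0 \<le> ?N * sigma2\<^sup>2" by simp
    ultimately show ?thesis by linarith
  qed
  finally show ?thesis .
qed

section \<open>The square of the centred Laplacian\<close>

text \<open>With \<open>D\<close> the diagonal matrix of centred degrees, this is the expansion of
  \<open>(D - A)^2\<close> into \<open>D^2 + A^2 - (D A + A D)\<close>.\<close>

lemma array_mult_lap:
  assumes "i < n" "j < n"
  shows "array_mult n (lap X) (lap X) i j =
    of_bool (i = j) * (deg X i)\<^sup>2 + walk2 X i j - adj X i j * (deg X i + deg X j)"
proof -
  have "array_mult n (lap X) (lap X) i j =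
     (\<Sum>k<n. (of_bool (k = j) * deg X i * deg X j) * of_bool (i = k) - (deg X i * adj X k j) * of_bool (i = k)
       - (adj X i k * deg X k) * of_bool (k = j) + adj X i k * adj X k j)"
    unfolding array_mult_def lap_def by (intro sum.cong refl) (simp add: algebra_simps)
  also have "\<dots> = (of_bool (i = j) * deg X i * deg X j) - deg X i * adj X i j - adj X i j * deg X j + walk2 X i j"
    unfolding sum.distrib sum_subtractf sum_mult_of_bool_eq_single(1)[OF assms(1)]
      sum_mult_of_bool_eq_single(2)[OF assms(2)] walk2_def array_mult_def ..
  finally show ?thesis by (auto simp: algebra_simps power2_eq_square)
qed

text \<open>The edge between \<open>i\<close> and \<open>j\<close> is counted in both degrees;
  separating it leaves a sum independent of it.\<close>

lemma deg_add_deg: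
  assumes "i < n" "j < n" "i \<noteq> j"
  shows "deg X i + deg X j = 2 * adj X i j + lin (double_star i j) X"
  unfolding deg_def sum_split_rest[OF assms] lin_double_star[OF assms(3)]
  by (simp add: adj_sym[of X j i])

text \<open>With \<open>x = adj X i j\<close>, \<open>W = walk2 X i j\<close> and \<open>S\<close>
  the double-star sum, the entry is \<open>W - 2 * x^2 - x * S\<close>. The cross terms have mean 0.
  Of the leading constant 3, \<open>W^2\<close> supplies 1 and \<open>x^2 * S^2\<close> supplies
  2.\<close>

lemma expec_lap_square_off_diag:
  assumes ij: "i < n" "j < n" "i \<noteq> j"
  shows "expec (\<lambda>X. (walk2 X i j - adj X i j * (deg X i + deg X j))\<^sup>2) \<le> 3 * real n * sigma2\<^sup>2 + 4"
proof -
  let ?S = "lin (double_star i j)"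
  note J = double_star_subset[OF ij(1,2)]
  note fS = free_of_lin_quad(1)[OF vertex_edge_notin_double_star[OF ij(3)]]
  note fW = free_of_walk2[OF ij]
  have f1: "free_of (vertex_edge i j) (\<lambda>X. walk2 X i j * ?S X)" "free_of (vertex_edge i j) (\<lambda>X. (?S X)\<^sup>2)"
    using fS fW by (auto simp: free_of_def)
  have "expec (\<lambda>X. (walk2 X i j - adj X i j * (deg X i + deg X j))\<^sup>2) =
     expec (\<lambda>X. (walk2 X i j)\<^sup>2 + ((-4) * ((adj X i j)\<^sup>2 * walk2 X i j) + ((-2) * (adj X i j * (walk2 X i j * ?S X))
       + (4 * (adj X i j ^ 4) + (4 * (adj X i j ^ 3 * ?S X) + (adj X i j)\<^sup>2 * (?S X)\<^sup>2)))))"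
    by (rule arg_cong[of _ _ expec])
      (simp add: fun_eq_iff deg_add_deg[OF ij] power2_eq_square numeral_eq_Suc algebra_simps)
  also have "\<dots> = (real n - 2) * sigma2\<^sup>2 + (4 * expec (\<lambda>X. adj X i j ^ 4) + sigma2 * (2 * (real n - 2) * sigma2))"
    unfolding expec_add expec_cmult expec_adj2[OF ij fW] expec_walk2[OF ij] expec_adj[OF ij f1(1)] expec_walk2_square[OF ij]
      expec_adj_odd3[OF ij fS expec_lin[OF J]] expec_adj2[OF ij f1(2)] expec_lin_square[OF J] card_double_star[OF ij]
    by simp
  also have "\<dots> \<le> (real n - 2) * sigma2\<^sup>2 + (4 * 1 + sigma2 * (2 * (real n - 2) * sigma2))"
    using expec_centred4_le[of "vertex_edge i j"] ij by (simp add: adj_def)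
  also have "\<dots> \<le> 3 * real n * sigma2\<^sup>2 + 4"
    by (simp add: power2_eq_square algebra_simps)
  finally show ?thesis .
qed

text \<open>The leading constant 9 is 6 from the \<open>n\<close> diagonal entries plus 3 from the
  off-diagonal ones.\<close>

lemma expec_frobenius_sq_lap2_le:
  "expec (\<lambda>X. frobenius_sq n (array_mult n (lap X) (lap X))) \<le> 9 * real n ^ 3 * sigma2\<^sup>2 + 8 * (real n)\<^sup>2"
proof -
  let ?N = "real n"
  have entry: "expec (\<lambda>X. (array_mult n (lap X) (lap X) i j)\<^sup>2) \<le>
     3 * ?N * sigma2\<^sup>2 + 4 + (6 * ?N\<^sup>2 * sigma2\<^sup>2 + 4 * ?N) * of_bool (i = j)"
    if "i < n" "j < n" for i j
  proof (cases "i = j")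
    case True
    have "expec (\<lambda>X. (array_mult n (lap X) (lap X) i j)\<^sup>2) = expec (\<lambda>X. ((lin (star i) X)\<^sup>2 + quad (star i) X)\<^sup>2)"
      using that by (simp add: array_mult_lap True walk2_diag flip: deg_eq_lin sqdeg_eq_quad)
    also have "\<dots> \<le> 6 * (card (star i))\<^sup>2 * sigma2\<^sup>2 + 4 * card (star i)"
      by (rule expec_lin2_quad_square_le[OF star_subset[OF that(1)]])
    also have "\<dots> \<le> 6 * ?N\<^sup>2 * sigma2\<^sup>2 + 4 * ?N"
      unfolding card_star[OF that(1)] of_nat_power
      by (intro add_mono mult_right_mono mult_left_mono power_mono) auto
    finally show ?thesis using True by (simp add: add_increasing)
  next
    case False
    then show ?thesis using expec_lap_square_off_diag[OF that False] that by (simp add: array_mult_lap)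
  qed
  have "expec (\<lambda>X. frobenius_sq n (array_mult n (lap X) (lap X))) \<le>
     (\<Sum>i<n. \<Sum>j<n. 3 * ?N * sigma2\<^sup>2 + 4 + (6 * ?N\<^sup>2 * sigma2\<^sup>2 + 4 * ?N) * of_bool (i = j))"
    unfolding frobenius_sq_def expec_sum using entry by (intro sum_mono) auto
  also have "\<dots> = ?N * (?N * (3 * ?N * sigma2\<^sup>2 + 4) + (6 * ?N\<^sup>2 * sigma2\<^sup>2 + 4 * ?N))"
    by (simp add: sum.distrib sum_mult_of_bool_eq_single del: sum_mult_of_bool_eq)
  also have "\<dots> = 9 * ?N ^ 3 * sigma2\<^sup>2 + 8 * ?N\<^sup>2"
    by (simp add: power2_eq_square power3_eq_cube algebra_simps)
  finally show ?thesis .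
qed

section \<open>Walks of length three\<close>

text \<open>The two interior vertices form a single index, so that the whole sum can be squared by
  orthogonality.\<close>

definition path3 :: "(nat set \<Rightarrow> bool) \<Rightarrow> nat \<Rightarrow> nat \<Rightarrow> nat \<times> nat \<Rightarrow> real" where
  "path3 X i j = (\<lambda>(k, l). adj X i k * adj X k l * adj X l j)"

definition pairs :: "nat set \<Rightarrow> (nat \<times> nat) set" where
  "pairs K = {(k, l). k \<in> K \<and> l \<in> K \<and> k \<noteq> l}"

lemma finite_pairs: "finite K \<Longrightarrow> finite (pairs K)"
  by (rule finite_subset[of _ "K \<times> K"]) (auto simp: pairs_def)

lemma card_pairs_le: "finite K \<Longrightarrow> card (pairs K) \<le> (card K)\<^sup>2"
  using card_mono[of "K \<times> K" "pairs K"] by (auto simp: pairs_def card_cartesian_product power2_eq_square)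

lemma sum_pairs_path3:
  assumes "finite K"
  shows "(\<Sum>s\<in>pairs K. path3 X i j s) = (\<Sum>l\<in>K. \<Sum>k\<in>K. adj X i k * adj X k l * adj X l j)"
proof -
  have "(\<Sum>s\<in>pairs K. path3 X i j s) = (\<Sum>s\<in>K \<times> K. path3 X i j s)"
    using assms by (intro sum.mono_neutral_left) (auto simp: pairs_def path3_def)
  also have "\<dots> = (\<Sum>k\<in>K. \<Sum>l\<in>K. adj X i k * adj X k l * adj X l j)"
    by (simp add: path3_def sum.cartesian_product)
  also have "\<dots> = (\<Sum>l\<in>K. \<Sum>k\<in>K. adj X i k * adj X k l * adj X l j)" by (rule sum.swap)
  finally show ?thesis .
qed

lemma walk3_eq: "walk3 X i j = (\<Sum>l<n. \<Sum>k<n. adj X i k * adj X k l * adj X l j)"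
  by (simp add: walk3_def array_mult_def sum_distrib_right)

text \<open>As the diagonal of \<open>adj\<close> vanishes, a contributing walk
  \<open>i, k, l, j\<close> either has both interior vertices outside \<open>{i, j}\<close> or has
  \<open>k = j\<close> or \<open>l = i\<close>. The last two cases use the edge between
  \<open>i\<close> and \<open>j\<close> and then go back and forth along an edge at one end.\<close>

lemma walk3_off_diag:
  assumes "i < n" "j < n" "i \<noteq> j"
  shows "walk3 X i j = (\<Sum>s\<in>pairs (rest i j). path3 X i j s)
    + adj X i j * ((adj X i j)\<^sup>2 + quad (double_star i j) X)"
  unfolding walk3_eq sum_split_rest[OF assms] sum_pairs_path3[OF finite_rest] quad_double_star[OF assms(3)]
  by (simp add: sum.distrib power2_eq_square adj_sym sum_distrib_left sum_distrib_right algebra_simps)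

lemma walk3_diag: "i < n \<Longrightarrow> walk3 X i i = (\<Sum>s\<in>pairs ({..<n} - {i}). path3 X i i s)"
  unfolding walk3_eq sum_pairs_path3[OF finite_Diff[OF finite_lessThan]]
  by (simp add: sum.remove[of "{..<n}" i])

lemma abs_path3_le: "\<bar>path3 X i j s\<bar> \<le> 1"
  unfolding path3_def
  by (cases s) (auto simp: abs_mult intro!: mult_le_one abs_adj_le)

lemma expec_path3_square_sum_le:
  assumes ij: "i < n" "j < n" "i \<noteq> j"
  shows "expec (\<lambda>X. (\<Sum>s\<in>pairs (rest i j). path3 X i j s)\<^sup>2) \<le> (real n)\<^sup>2 * sigma2 ^ 3"
proof -
  have "expec (\<lambda>X. (\<Sum>s\<in>pairs (rest i j). path3 X i j s)\<^sup>2) =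
      (\<Sum>s\<in>pairs (rest i j). expec (\<lambda>X. (path3 X i j s)\<^sup>2))"
  proof (rule expec_sum_square)
    fix s t assume st: "s \<in> pairs (rest i j)" "t \<in> pairs (rest i j)" "s \<noteq> t"
    obtain k l k' l' where s: "s = (k, l)" and t: "t = (k', l')" by (cases s, cases t) auto
    \<comment> \<open>If the first interior vertices differ, the first edge of \<open>s\<close>
      occurs only once in the product; otherwise the second ones differ and its last edge occurs
      only once.\<close>
    show "expec (\<lambda>X. path3 X i j s * path3 X i j t) = 0"
    proof (cases "k = k'")
      case False
      have "expec (\<lambda>X. adj X i k * (adj X k l * adj X l j * (adj X i k' * adj X k' l' * adj X l' j))) = 0"
        using ij st False
        by (intro expec_adj) (auto simp: s t pairs_def free_of_def rest_def adj_upd vertex_edge_eq_iff)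
      then show ?thesis by (simp add: s t path3_def mult_ac)
    next
      case True
      have "expec (\<lambda>X. adj X l j * (adj X i k * adj X k l * (adj X i k' * adj X k' l' * adj X l' j))) = 0"
        using ij st True
        by (intro expec_adj) (auto simp: s t pairs_def free_of_def rest_def adj_upd vertex_edge_eq_iff)
      then show ?thesis by (simp add: s t path3_def mult_ac)
    qed
  qed (intro finite_pairs finite_rest)
  also have "\<dots> = (\<Sum>s\<in>pairs (rest i j). sigma2 ^ 3)"
  proof (rule sum.cong[OF refl])
    fix s assume st: "s \<in> pairs (rest i j)"
    obtain k l where s: "s = (k, l)" by (cases s) auto
    have "expec (\<lambda>X. (adj X i k)\<^sup>2 * ((adj X k l)\<^sup>2 * ((adj X l j)\<^sup>2 * 1))) = sigma2 * expec (\<lambda>X. (adj X k l)\<^sup>2 * ((adj X l j)\<^sup>2 * 1))"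
      using ij st by (intro expec_adj2) (auto simp: s pairs_def free_of_def rest_def adj_upd vertex_edge_eq_iff)
    also have "expec (\<lambda>X. (adj X k l)\<^sup>2 * ((adj X l j)\<^sup>2 * 1)) = sigma2 * expec (\<lambda>X. (adj X l j)\<^sup>2 * 1)"
      using ij st by (intro expec_adj2) (auto simp: s pairs_def free_of_def rest_def adj_upd vertex_edge_eq_iff)
    also have "expec (\<lambda>X. (adj X l j)\<^sup>2 * 1) = sigma2 * expec (\<lambda>X. 1)"
      using ij st by (intro expec_adj2) (auto simp: s pairs_def free_of_def rest_def)
    finally show "expec (\<lambda>X. (path3 X i j s)\<^sup>2) = sigma2 ^ 3"
      by (simp add: s path3_def expec_const power_mult_distrib power3_eq_cube mult.assoc)
  qed
  also have "\<dots> = card (pairs (rest i j)) * sigma2 ^ 3" by simp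
  also have "\<dots> \<le> (real n)\<^sup>2 * sigma2 ^ 3"
  proof (rule mult_right_mono)
    have "card (rest i j) \<le> n" using card_rest[OF ij] by simp
    then have "card (pairs (rest i j)) \<le> n\<^sup>2"
      using card_pairs_le[OF finite_rest[of i j]] by (meson order_trans power_mono zero_le)
    then show "real (card (pairs (rest i j))) \<le> (real n)\<^sup>2"
      by (metis of_nat_le_iff of_nat_power)
  qed (use sigma2_pos in simp)
  finally show ?thesis .
qed

lemma expec_path3_sum:
  assumes ij: "i < n" "j < n" "i \<noteq> j"
  shows "expec (\<lambda>X. \<Sum>s\<in>pairs (rest i j). path3 X i j s) = 0"
  unfolding expec_sum
proof (rule sum.neutral, rule ballI)
  fix s assume st: "s \<in> pairs (rest i j)"
  obtain k l where s: "s = (k, l)" by (cases s) auto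
  have "expec (\<lambda>X. adj X i k * (adj X k l * adj X l j)) = 0"
    using ij st by (intro expec_adj) (auto simp: s pairs_def free_of_def rest_def adj_upd vertex_edge_eq_iff)
  then show "expec (\<lambda>X. path3 X i j s) = 0" by (simp add: s path3_def mult_ac)
qed

text \<open>A crude bound suffices: the \<open>n\<close> diagonal entries together contribute order
  \<open>n^3\<close>, below the main order \<open>n^4\<close>.\<close>

lemma expec_walk3_diag_le:
  assumes i: "i < n"
  shows "expec (\<lambda>X. (walk3 X i i)\<^sup>2) \<le> 2 * (real n)\<^sup>2"
proof -
  let ?T = "pairs ({..<n} - {i})"
  have fin: "finite ?T" by (intro finite_pairs) simp
  have le: "expec (\<lambda>X. path3 X i i s * path3 X i i t) \<le> of_bool (t = s) + of_bool (t = prod.swap s)"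
    if st: "s \<in> ?T" "t \<in> ?T" for s t
  proof (cases "t = s \<or> t = prod.swap s")
    case True
    have "expec (\<lambda>X. path3 X i i s * path3 X i i t) \<le> expec (\<lambda>X. 1)"
    proof (rule expec_mono)
      fix X
      have "\<bar>path3 X i i s * path3 X i i t\<bar> \<le> 1"
        by (simp add: abs_mult abs_path3_le mult_le_one)
      then show "path3 X i i s * path3 X i i t \<le> 1" by linarith
    qed
    then show ?thesis using True by (auto simp: expec_const)
  next
    case False
    obtain k l k' l' where s: "s = (k, l)" and t: "t = (k', l')" by (cases s, cases t) auto
    \<comment> \<open>The edge opposite to \<open>i\<close> determines a triangle up to orientation,
      so here it occurs only once.\<close>
    have "expec (\<lambda>X. adj X k l * (adj X i k * adj X l i * (adj X i k' * adj X k' l' * adj X l' i))) = 0"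
      using i st False
      by (intro expec_adj) (auto simp: s t pairs_def free_of_def adj_upd vertex_edge_eq_iff)
    then have "expec (\<lambda>X. path3 X i i s * path3 X i i t) = 0" by (simp add: s t path3_def mult_ac)
    then show ?thesis by simp
  qed
  have "expec (\<lambda>X. (walk3 X i i)\<^sup>2) = (\<Sum>s\<in>?T. \<Sum>t\<in>?T. expec (\<lambda>X. path3 X i i s * path3 X i i t))"
    unfolding walk3_diag[OF i] by (simp add: power2_eq_square sum_product expec_sum)
  also have "\<dots> \<le> (\<Sum>s\<in>?T. \<Sum>t\<in>?T. (if t = s then 1 else 0) + (if t = prod.swap s then 1 else 0))"
    using le by (intro sum_mono) (auto simp: of_bool_def)
  also have "\<dots> \<le> (\<Sum>s\<in>?T. 2)"
    using fin by (intro sum_mono) (simp add: sum.distrib)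
  also have "\<dots> = 2 * real (card ?T)" by simp
  also have "\<dots> \<le> 2 * (real n)\<^sup>2"
  proof -
    have "card ({..<n} - {i}) \<le> n" by (metis card_Diff1_le card_lessThan)
    then have "card ?T \<le> n\<^sup>2"
      using card_pairs_le[of "{..<n} - {i}"] by (meson finite_Diff finite_lessThan order_trans power_mono zero_le)
    then have "real (card ?T) \<le> (real n)\<^sup>2" by (metis of_nat_le_iff of_nat_power)
    then show ?thesis by simp
  qed
  finally show ?thesis .
qed

text \<open>With \<open>x = adj X i j\<close> the entry is \<open>P + x * (x^2 + Q)\<close>. The
  constant 5 is 1 from \<open>P^2\<close> plus 4 from \<open>x^2 * Q^2\<close>, where
  \<open>Q\<close> has mean about \<open>2 * n * sigma2\<close>.\<close>

lemma expec_walk3_off_diag_le: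
  assumes ij: "i < n" "j < n" "i \<noteq> j"
  shows "expec (\<lambda>X. (walk3 X i j)\<^sup>2) \<le> 5 * (real n)\<^sup>2 * sigma2 ^ 3 + 7 * real n"
proof -
  let ?N = "real n"
  define P where "P X = (\<Sum>s\<in>pairs (rest i j). path3 X i j s)" for X
  define Q where "Q = quad (double_star i j)"
  note J = double_star_subset[OF ij(1,2)]
  have fQ: "free_of (vertex_edge i j) Q"
    unfolding Q_def by (rule free_of_lin_quad(2)[OF vertex_edge_notin_double_star[OF ij(3)]])
  have fP: "free_of (vertex_edge i j) P"
    unfolding P_def[abs_def]
    by (intro free_of_sum) (use ij in \<open>auto simp: path3_def pairs_def free_of_def rest_def adj_upd vertex_edge_eq_iff\<close>)
  have f: "free_of (vertex_edge i j) (\<lambda>X. P X * Q X)" "free_of (vertex_edge i j) (\<lambda>X. (Q X)\<^sup>2)"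
    using fP fQ by (auto simp: free_of_def)
  have Q0: "Q X \<ge> 0" for X by (simp add: Q_def quad_def sum_nonneg)
  have exP: "expec P = 0" using expec_path3_sum[OF ij] by (simp add: P_def[abs_def])
  have cJ: "real (card (double_star i j)) \<le> 2 * ?N" using card_double_star[OF ij] by simp
  have exQ: "expec Q \<le> 2 * ?N"
  proof -
    have "expec Q \<le> real (card (double_star i j)) * 1"
      unfolding Q_def expec_quad[OF J] using sigma2_le by (intro mult_left_mono) auto
    then show ?thesis using cJ by simp
  qed
  have exQ2: "expec (\<lambda>X. (Q X)\<^sup>2) \<le> (2 * ?N)\<^sup>2 * sigma2\<^sup>2 + 2 * ?N"
  proof -
    have "expec (\<lambda>X. (Q X)\<^sup>2) \<le> (real (card (double_star i j)))\<^sup>2 * sigma2\<^sup>2 + real (card (double_star i j))"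
      unfolding Q_def using expec_quad_square_le[OF J] by simp
    also have "\<dots> \<le> (2 * ?N)\<^sup>2 * sigma2\<^sup>2 + 2 * ?N"
      using cJ by (intro add_mono mult_right_mono power_mono) auto
    finally show ?thesis .
  qed
  \<comment> \<open>Powers 4 and 6 of the entry are lowered to 2 and 0 before averaging, so only its
    variance is needed in these terms.\<close>
  have "expec (\<lambda>X. (walk3 X i j)\<^sup>2) \<le>
      expec (\<lambda>X. (P X)\<^sup>2 + (2 * (adj X i j ^ 3 * P X) + (2 * (adj X i j * (P X * Q X))
        + (1 + (2 * ((adj X i j)\<^sup>2 * Q X) + (adj X i j)\<^sup>2 * (Q X)\<^sup>2)))))"
  proof (rule expec_mono)
    fix X
    define b where "b = adj X i j"
    have "\<bar>b\<bar> \<le> 1" by (simp add: b_def abs_adj_le)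
    then have b: "b\<^sup>2 \<le> 1" by (simp add: abs_square_le_1)
    have 1: "b ^ 6 \<le> 1"
    proof -
      have "(b\<^sup>2) ^ 3 \<le> 1" by (rule power_le_one) (use b in auto)
      then show ?thesis by (simp flip: power_mult)
    qed
    have 2: "b ^ 4 * Q X \<le> b\<^sup>2 * Q X"
    proof -
      have "b ^ 4 = b\<^sup>2 * b\<^sup>2" by (simp flip: power_add)
      also have "\<dots> \<le> b\<^sup>2 * 1" using b by (intro mult_left_mono) auto
      finally show ?thesis using Q0[of X] by (intro mult_right_mono) auto
    qed
    have "(walk3 X i j)\<^sup>2 = (P X + b * (b\<^sup>2 + Q X))\<^sup>2"
      unfolding walk3_off_diag[OF ij] P_def Q_def b_def ..
    also have "\<dots> = (P X)\<^sup>2 + (2 * (b ^ 3 * P X) + (2 * (b * (P X * Q X))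
        + (b ^ 6 + (2 * (b ^ 4 * Q X) + b\<^sup>2 * (Q X)\<^sup>2))))"
      by (simp add: power2_eq_square numeral_eq_Suc algebra_simps)
    also have "\<dots> \<le> (P X)\<^sup>2 + (2 * (b ^ 3 * P X) + (2 * (b * (P X * Q X))
        + (1 + (2 * (b\<^sup>2 * Q X) + b\<^sup>2 * (Q X)\<^sup>2))))"
      using 1 2 by linarith
    finally show "(walk3 X i j)\<^sup>2 \<le> (P X)\<^sup>2 + (2 * (adj X i j ^ 3 * P X) + (2 * (adj X i j * (P X * Q X))
        + (1 + (2 * ((adj X i j)\<^sup>2 * Q X) + (adj X i j)\<^sup>2 * (Q X)\<^sup>2))))" by (simp add: b_def)
  qed
  also have "\<dots> = expec (\<lambda>X. (P X)\<^sup>2) + (1 + (2 * (sigma2 * expec Q) + sigma2 * expec (\<lambda>X. (Q X)\<^sup>2)))"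
    unfolding expec_add expec_cmult expec_const expec_adj_odd3[OF ij fP exP] expec_adj[OF ij f(1)] expec_adj2[OF ij fQ] expec_adj2[OF ij f(2)]
    by simp
  also have "\<dots> \<le> ?N\<^sup>2 * sigma2 ^ 3 + (1 + (2 * (1 * (2 * ?N)) + sigma2 * ((2 * ?N)\<^sup>2 * sigma2\<^sup>2 + 2 * ?N)))"
  proof (intro add_mono mult_left_mono order_refl)
    show "expec (\<lambda>X. (P X)\<^sup>2) \<le> ?N\<^sup>2 * sigma2 ^ 3" unfolding P_def by (rule expec_path3_square_sum_le[OF ij])
    show "sigma2 * expec Q \<le> 1 * (2 * ?N)"
      using sigma2_pos sigma2_le exQ by (intro mult_mono) (auto simp: Q_def expec_quad[OF J])
  qed (use exQ2 sigma2_pos in auto)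
  also have "\<dots> \<le> 5 * ?N\<^sup>2 * sigma2 ^ 3 + 7 * ?N"
  proof -
    have "sigma2 * ?N \<le> 1 * ?N" using sigma2_le by (intro mult_right_mono) auto
    moreover have "sigma2 * ((2 * ?N)\<^sup>2 * sigma2\<^sup>2 + 2 * ?N) = 4 * (?N\<^sup>2 * sigma2 ^ 3) + 2 * (sigma2 * ?N)"
      by (simp add: power2_eq_square power3_eq_cube algebra_simps)
    moreover have "1 \<le> ?N" using ij by simp
    ultimately show ?thesis by linarith
  qed
  finally show ?thesis .
qed

text \<open>The leading constant 5 is the third Catalan number, the sixth moment of the semicircle
  law.\<close>

lemma expec_frobenius_sq_walk3_le:
  "expec (\<lambda>X. frobenius_sq n (walk3 X)) \<le> 5 * real n ^ 4 * sigma2 ^ 3 + 9 * real n ^ 3"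
proof -
  let ?N = "real n"
  have nn: "0 \<le> 5 * ?N\<^sup>2 * sigma2 ^ 3 + 7 * ?N" using sigma2_pos by simp
  have entry: "expec (\<lambda>X. (walk3 X i j)\<^sup>2) \<le> (5 * ?N\<^sup>2 * sigma2 ^ 3 + 7 * ?N) + (2 * ?N\<^sup>2) * of_bool (i = j)"
    if "i < n" "j < n" for i j
    using expec_walk3_diag_le[OF that(1)] expec_walk3_off_diag_le[OF that] nn by (cases "i = j") auto
  have "expec (\<lambda>X. frobenius_sq n (walk3 X)) \<le> (\<Sum>i<n. \<Sum>j<n. (5 * ?N\<^sup>2 * sigma2 ^ 3 + 7 * ?N) + (2 * ?N\<^sup>2) * of_bool (i = j))"
    unfolding frobenius_sq_def expec_sum using entry by (intro sum_mono) auto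
  also have "\<dots> = ?N * (?N * (5 * ?N\<^sup>2 * sigma2 ^ 3 + 7 * ?N) + 2 * ?N\<^sup>2)"
    by (simp add: sum.distrib sum_mult_of_bool_eq_single del: sum_mult_of_bool_eq)
  also have "\<dots> = 5 * ?N ^ 4 * sigma2 ^ 3 + 9 * ?N ^ 3"
    by (simp add: power2_eq_square power3_eq_cube power4_eq_xxxx algebra_simps)
  finally show ?thesis .
qed

end

section \<open>Polynomial bounds for the absolute value and the trace norm\<close>

text \<open>Contact at \<open>\<bar>x\<bar> = 2 * s\<close>, a rational substitute for the factor \<open>sqrt (9/2)\<close> that is optimal for the
  limiting moments 2 and 9.\<close>

lemma abs_ge_quartic:
  fixes x s :: real
  assumes s: "s > 0"
  shows "\<bar>x\<bar> \<ge> 3 / 4 * (x ^ 2 / s) - x ^ 4 / s ^ 3 / 16"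
proof -
  define y where "y = \<bar>x\<bar> / s"
  have y: "y \<ge> 0" "\<bar>x\<bar> = y * s" using s by (auto simp: y_def)
  have "x ^ 2 = (y * s) ^ 2" "x ^ 4 = (y * s) ^ 4"
    using y(2) by (metis even_numeral power_even_abs)+
  then have eq: "x ^ 2 / s = s * y ^ 2" "x ^ 4 / s ^ 3 = s * y ^ 4"
    using s by (auto simp: power_mult_distrib field_simps power2_eq_square power3_eq_cube power4_eq_xxxx)
  \<comment> \<open>The double root at 2 is the point of contact.\<close>
  have "0 \<le> s * (y * (y - 2)\<^sup>2 * (y + 4))" using y s by simp
  also have "\<dots> = 16 * (y * s) - 12 * (s * y ^ 2) + s * y ^ 4"
    by (simp add: power2_eq_square power4_eq_xxxx algebra_simps)
  finally show ?thesis unfolding eq y(2) by simp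
qed

text \<open>The right-hand side is the even sextic that touches \<open>10 * sqrt 5 * \<bar>y\<bar>\<close> at the golden ratio and
  its inverse, the square roots of the two-point Gauss quadrature nodes for the squared semicircle law.\<close>

lemma abs_le_sextic:
  fixes x s :: real
  assumes s: "s > 0"
  shows "22 * \<bar>x\<bar> \<le> x ^ 6 / s ^ 5 - 7 * (x ^ 4 / s ^ 3) + 23 * (x ^ 2 / s) + 6 * s"
proof -
  define y where "y = \<bar>x\<bar> / s"
  have y: "y \<ge> 0" "\<bar>x\<bar> = y * s" using s by (auto simp: y_def)
  have "x ^ 2 = (y * s) ^ 2" "x ^ 4 = (y * s) ^ 4" "x ^ 6 = (y * s) ^ 6"
    using y(2) by (metis even_numeral power_even_abs)+
  then have eq: "x ^ 2 / s = s * y ^ 2" "x ^ 4 / s ^ 3 = s * y ^ 4" "x ^ 6 / s ^ 5 = s * y ^ 6"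
    using s by (auto simp: power_mult_distrib field_simps numeral_eq_Suc)
  define c where "c = sqrt (5 :: real)"
  have cc: "c * c = 5" by (simp add: c_def)
  have c: "c \<ge> 11 / 5" unfolding c_def by (rule real_le_rsqrt) (simp add: power2_eq_square)
  have cc': "c * (c * z) = 5 * z" for z by (simp add: cc flip: mult.assoc)
  \<comment> \<open>With \<open>c = sqrt 5\<close> the squared factor vanishes at the golden ratio
    and its inverse. The bound \<open>11 / 5\<close> for \<open>c\<close> turns the slope
    \<open>10 * c\<close> into 22.\<close>
  have "0 \<le> (y\<^sup>2 - c * y + 1)\<^sup>2 * (y\<^sup>2 + 2 * c * y + 6)" using y c by (intro mult_nonneg_nonneg) auto
  also have "\<dots> = y ^ 6 - 7 * y ^ 4 + 23 * y ^ 2 + 6 - 10 * (c * y)"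
    by (simp add: power2_eq_square numeral_eq_Suc algebra_simps cc cc')
  finally have "10 * (c * y) \<le> y ^ 6 - 7 * y ^ 4 + 23 * y ^ 2 + 6" by simp
  moreover have "11 / 5 * y \<le> c * y" using c y by (intro mult_right_mono) auto
  ultimately have "22 * y \<le> y ^ 6 - 7 * y ^ 4 + 23 * y ^ 2 + 6" by simp
  then have "s * (22 * y) \<le> s * (y ^ 6 - 7 * y ^ 4 + 23 * y ^ 2 + 6)" using s by simp
  then show ?thesis unfolding eq y(2) by (simp add: algebra_simps)
qed

lemma trace_norm_ge_moments:
  assumes "\<And>i j. i < n \<Longrightarrow> j < n \<Longrightarrow> a i j = a j i" and s: "s > 0"
  shows "array_trace_norm n a \<ge> 3 / 4 * (frobenius_sq n a / s) - frobenius_sq n (array_mult n a a) / s ^ 3 / 16"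
proof -
  obtain l where l: "array_trace_norm n a = (\<Sum>k<n. \<bar>l k\<bar>)" "frobenius_sq n a = (\<Sum>k<n. l k ^ 2)"
    "frobenius_sq n (array_mult n a a) = (\<Sum>k<n. l k ^ 4)"
    using trace_norm_moments[of n a] assms(1) by metis
  have "(\<Sum>k<n. 3 / 4 * (l k ^ 2 / s) - l k ^ 4 / s ^ 3 / 16) \<le> (\<Sum>k<n. \<bar>l k\<bar>)"
    by (intro sum_mono abs_ge_quartic s)
  then show ?thesis
    unfolding l by (simp add: sum_subtractf sum_distrib_left sum_divide_distrib)
qed

lemma trace_norm_le_moments:
  assumes "\<And>i j. i < n \<Longrightarrow> j < n \<Longrightarrow> a i j = a j i" and s: "s > 0"
  shows "22 * array_trace_norm n a \<le> frobenius_sq n (array_mult n (array_mult n a a) a) / s ^ 5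
    - 7 * (frobenius_sq n (array_mult n a a) / s ^ 3) + 23 * (frobenius_sq n a / s) + 6 * s * n"
proof -
  obtain l where l: "array_trace_norm n a = (\<Sum>k<n. \<bar>l k\<bar>)" "frobenius_sq n a = (\<Sum>k<n. l k ^ 2)"
    "frobenius_sq n (array_mult n a a) = (\<Sum>k<n. l k ^ 4)"
    "frobenius_sq n (array_mult n (array_mult n a a) a) = (\<Sum>k<n. l k ^ 6)"
    using trace_norm_moments[of n a] assms(1) by metis
  have "(\<Sum>k<n. 22 * \<bar>l k\<bar>) \<le> (\<Sum>k<n. l k ^ 6 / s ^ 5 - 7 * (l k ^ 4 / s ^ 3) + 23 * (l k ^ 2 / s) + 6 * s)"
    by (intro sum_mono abs_le_sextic s)
  then show ?thesis
    unfolding l by (simp add: sum.distrib sum_subtractf sum_distrib_left sum_divide_distrib mult_ac)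
qed

section \<open>Lower bound for the mean of the gap\<close>

context random_graph
begin

definition total_deg :: "(nat set \<Rightarrow> bool) \<Rightarrow> real" where "total_deg X = (\<Sum>i<n. deg X i)"

text \<open>Subtracting the absolute total degree pays for the random part of the average degree in
  the centred Laplacian. The other losses are deterministic and linear in \<open>n\<close>.\<close>

definition gap :: "(nat set \<Rightarrow> bool) \<Rightarrow> real" where
  "gap X = array_trace_norm n (lap X) - array_trace_norm n (adj X) - \<bar>total_deg X\<bar>"

lemma lap_sym: "lap X i j = lap X j i"
  by (simp add: lap_def adj_sym of_bool_def)

text \<open>An off-diagonal entry is correlated only with itself and with its transpose.\<close>

lemma expec_total_square_le: "expec (\<lambda>X. (total_deg X)\<^sup>2) \<le> 2 * (real n)\<^sup>2"
proof -
  let ?T = "pairs {..<n}"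
  let ?m = "\<lambda>X s. adj X (fst s) (snd s)"
  have fin: "finite ?T" by (intro finite_pairs) simp
  have le: "expec (\<lambda>X. ?m X s * ?m X t) \<le> of_bool (t = s) + of_bool (t = prod.swap s)"
    if st: "s \<in> ?T" "t \<in> ?T" for s t
  proof (cases "t = s \<or> t = prod.swap s")
    case True
    have "expec (\<lambda>X. ?m X s * ?m X t) \<le> expec (\<lambda>X. 1)"
    proof (rule expec_mono)
      fix X
      have "\<bar>?m X s * ?m X t\<bar> \<le> 1"
        by (simp add: abs_mult abs_adj_le mult_le_one)
      then show "?m X s * ?m X t \<le> 1" by linarith
    qed
    then have "expec (\<lambda>X. ?m X s * ?m X t) \<le> 1" by (simp only: expec_const)
    moreover have "1 \<le> of_bool (t = s) + (of_bool (t = prod.swap s) :: real)" using True by auto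
    ultimately show ?thesis by linarith
  next
    case False
    then have "vertex_edge (fst s) (snd s) \<noteq> vertex_edge (fst t) (snd t)" by (cases s, cases t) (auto simp: vertex_edge_eq_iff)
    then have "expec (\<lambda>X. ?m X s * ?m X t) = 0"
      using st by (intro expec_adj) (auto simp: pairs_def free_of_def adj_upd)
    then show ?thesis by simp
  qed
  have tot: "total_deg X = (\<Sum>s\<in>?T. ?m X s)" for X
  proof -
    have "total_deg X = (\<Sum>s\<in>{..<n} \<times> {..<n}. ?m X s)"
      unfolding total_deg_def deg_def by (simp add: sum.cartesian_product case_prod_unfold)
    also have "\<dots> = (\<Sum>s\<in>?T. ?m X s)"
      by (intro sum.mono_neutral_right) (auto simp: pairs_def)
    finally show ?thesis .
  qed
  have "expec (\<lambda>X. (total_deg X)\<^sup>2) = (\<Sum>s\<in>?T. \<Sum>t\<in>?T. expec (\<lambda>X. ?m X s * ?m X t))"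
    unfolding tot by (simp add: power2_eq_square sum_product expec_sum)
  also have "\<dots> \<le> (\<Sum>s\<in>?T. \<Sum>t\<in>?T. (if t = s then 1 else 0) + (if t = prod.swap s then 1 else 0))"
    using le by (intro sum_mono) (auto simp: of_bool_def)
  also have "\<dots> \<le> (\<Sum>s\<in>?T. 2)"
    using fin by (intro sum_mono) (simp add: sum.distrib)
  also have "\<dots> = 2 * real (card ?T)" by simp
  also have "\<dots> \<le> 2 * (real n)\<^sup>2"
    using card_pairs_le[of "{..<n}"] by (simp flip: of_nat_power)
  finally show ?thesis .
qed

text \<open>AM-GM in the form \<open>\<bar>t\<bar> \<le> t^2 / (2 * N) + N / 2\<close> passes from
  the second moment to the first.\<close>

lemma expec_abs_total_le: 
  assumes "n > 0"
  shows "expec (\<lambda>X. \<bar>total_deg X\<bar>) \<le> 2 * real n"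
proof -
  let ?N = "real n"
  have "\<bar>t\<bar> \<le> t\<^sup>2 * (1 / (2 * ?N)) + ?N / 2" for t :: real
  proof -
    have "0 \<le> (\<bar>t\<bar> - ?N)\<^sup>2" by simp
    then have "2 * ?N * \<bar>t\<bar> \<le> t\<^sup>2 + ?N\<^sup>2" by (simp add: power2_diff mult_ac)
    then show ?thesis using assms by (simp add: field_simps power2_eq_square)
  qed
  then have "expec (\<lambda>X. \<bar>total_deg X\<bar>) \<le> expec (\<lambda>X. 1 / (2 * ?N) * (total_deg X)\<^sup>2 + ?N / 2)"
    by (intro expec_mono) (simp add: mult.commute)
  also have "\<dots> = 1 / (2 * ?N) * expec (\<lambda>X. (total_deg X)\<^sup>2) + ?N / 2"
    by (simp only: expec_add expec_cmult expec_const)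
  also have "\<dots> \<le> 1 / (2 * ?N) * (2 * ?N\<^sup>2) + ?N / 2"
    by (intro add_mono mult_left_mono expec_total_square_le) auto
  also have "\<dots> \<le> 2 * ?N" using assms by (simp add: power2_eq_square)
  finally show ?thesis .
qed

text \<open>As \<open>s\<close> has order \<open>sqrt n\<close>, the terms in \<open>s\<close>,
  \<open>N^2 / s^3\<close> and \<open>N^3 / s^5\<close> have order \<open>sqrt n\<close>, and
  \<open>N * s\<close> dominates. Its factor is 5 / 176 = 15 / 16 - 20 / 22.\<close>

lemma expec_gap_ge:
  assumes n: "n > 0"
  defines "N \<equiv> real n" and "s \<equiv> sqrt (sigma2 * real n)"
  shows "expec gap \<ge> 5 / 176 * (N * s) - 3 / 2 * s - 3 * (N\<^sup>2 / s ^ 3) - N ^ 3 / s ^ 5 - 2 * N"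
proof -
  have N: "N > 0" using n by (simp add: N_def)
  have s: "s > 0" using n sigma2_pos by (simp add: s_def)
  have ss: "sigma2 = s\<^sup>2 / N" using n sigma2_pos by (simp add: s_def N_def)
  have pw: "s\<^sup>2 / s = s" "s ^ 4 / s ^ 3 = s" "s ^ 6 / s ^ 5 = s"
    using s by (auto simp: field_simps numeral_eq_Suc)
  \<comment> \<open>The factor is 15 / 16 = 3 / 4 * 2 - 9 / 16, from the limiting moments 2 and
    9.\<close>
  have L: "expec (\<lambda>X. array_trace_norm n (lap X)) \<ge> 15 / 16 * (N * s) - 3 / 2 * s - N\<^sup>2 / s ^ 3 / 2"
  proof -
    have "expec (\<lambda>X. array_trace_norm n (lap X)) \<ge>
        expec (\<lambda>X. 3 / 4 / s * frobenius_sq n (lap X) - 1 / s ^ 3 / 16 * frobenius_sq n (array_mult n (lap X) (lap X)))"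
    proof (rule expec_mono)
      fix X
      show "3 / 4 / s * frobenius_sq n (lap X) - 1 / s ^ 3 / 16 * frobenius_sq n (array_mult n (lap X) (lap X)) \<le> array_trace_norm n (lap X)"
        using trace_norm_ge_moments[of n "lap X" s] s lap_sym by simp
    qed
    also have "expec (\<lambda>X. 3 / 4 / s * frobenius_sq n (lap X) - 1 / s ^ 3 / 16 * frobenius_sq n (array_mult n (lap X) (lap X)))
       \<ge> 3 / 4 / s * (2 * (N * ((N - 1) * sigma2))) - 1 / s ^ 3 / 16 * (9 * N ^ 3 * sigma2\<^sup>2 + 8 * N\<^sup>2)"
      unfolding expec_diff expec_cmult expec_frobenius_sq_lap N_def using expec_frobenius_sq_lap2_le s
      by (intro diff_left_mono mult_left_mono) auto
    also have "3 / 4 / s * (2 * (N * ((N - 1) * sigma2))) - 1 / s ^ 3 / 16 * (9 * N ^ 3 * sigma2\<^sup>2 + 8 * N\<^sup>2)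
      = 3 / 2 * (N - 1) * (s\<^sup>2 / s) - 9 / 16 * N * (s ^ 4 / s ^ 3) - N\<^sup>2 / s ^ 3 / 2"
      unfolding ss using N s by (simp add: field_simps power2_eq_square power3_eq_cube power4_eq_xxxx)
    also have "\<dots> = 15 / 16 * (N * s) - 3 / 2 * s - N\<^sup>2 / s ^ 3 / 2"
      unfolding pw by (simp add: field_simps)
    finally show ?thesis .
  qed
  \<comment> \<open>The factor is 20 = 5 - 7 * 2 + 23 + 6, from the limiting moments 5, 2 and
    1.\<close>
  have A: "22 * expec (\<lambda>X. array_trace_norm n (adj X)) \<le> 20 * (N * s) + 9 * (N ^ 3 / s ^ 5) + 35 * (N\<^sup>2 / s ^ 3)"
  proof -
    have "expec (\<lambda>X. 22 * array_trace_norm n (adj X)) \<le> expec (\<lambda>X. 1 / s ^ 5 * frobenius_sq n (walk3 X)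
        - 7 / s ^ 3 * frobenius_sq n (walk2 X) + 23 / s * frobenius_sq n (adj X) + 6 * s * N)"
    proof (rule expec_mono)
      fix X
      show "22 * array_trace_norm n (adj X) \<le> 1 / s ^ 5 * frobenius_sq n (walk3 X)
        - 7 / s ^ 3 * frobenius_sq n (walk2 X) + 23 / s * frobenius_sq n (adj X) + 6 * s * N"
        using trace_norm_le_moments[of n "adj X" s] s adj_sym unfolding walk3_def walk2_def N_def by simp
    qed
    also have "\<dots> \<le> 1 / s ^ 5 * (5 * N ^ 4 * sigma2 ^ 3 + 9 * N ^ 3) - 7 / s ^ 3 * (2 * N ^ 3 * sigma2\<^sup>2 - 5 * N\<^sup>2)
        + 23 / s * (N * ((N - 1) * sigma2)) + 6 * s * N"
      unfolding expec_diff expec_add expec_cmult expec_const expec_frobenius_sq_adj N_def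
      using expec_frobenius_sq_walk3_le expec_frobenius_sq_walk2_ge s
      by (intro add_mono diff_mono mult_left_mono order_refl) auto
    also have "\<dots> = 5 * N * (s ^ 6 / s ^ 5) + 9 * (N ^ 3 / s ^ 5) - 14 * N * (s ^ 4 / s ^ 3) + 35 * (N\<^sup>2 / s ^ 3)
        + 23 * (N - 1) * (s\<^sup>2 / s) + 6 * s * N"
      unfolding ss using N s by (simp add: field_simps numeral_eq_Suc)
    also have "\<dots> \<le> 20 * (N * s) + 9 * (N ^ 3 / s ^ 5) + 35 * (N\<^sup>2 / s ^ 3)"
      unfolding pw using s by (simp add: algebra_simps)
    finally show ?thesis unfolding expec_cmult .
  qed
  have T: "expec (\<lambda>X. \<bar>total_deg X\<bar>) \<le> 2 * N" unfolding N_def by (rule expec_abs_total_le[OF n])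
  have "expec gap = expec (\<lambda>X. array_trace_norm n (lap X)) - expec (\<lambda>X. array_trace_norm n (adj X)) - expec (\<lambda>X. \<bar>total_deg X\<bar>)"
    unfolding gap_def[abs_def] expec_diff ..
  moreover have "N ^ 3 / s ^ 5 \<ge> 0" "N\<^sup>2 / s ^ 3 \<ge> 0" using N s by auto
  \<comment> \<open>Naming these quotients leaves a linear inequality. The error factors 1 / 2 + 35
    / 22 and 9 / 22 are rounded up to 3 and 1.\<close>
  moreover define a b c where "a = N * s" and "b = N\<^sup>2 / s ^ 3" and "c = N ^ 3 / s ^ 5"
  ultimately show ?thesis using L A T unfolding a_def[symmetric] b_def[symmetric] c_def[symmetric] by simp
qed

subsection \<open>Concentration and comparison of the energies\<close>

lemma all_edges_cases:
  assumes "e \<in> all_edges n"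
  obtains i j where "i < n" "j < n" "i \<noteq> j" "e = vertex_edge i j"
proof -
  have e: "e \<subseteq> {1..n}" "card e = 2" using assms by (auto simp: all_edges_def)
  then obtain x y where xy: "e = {x, y}" "x \<noteq> y" by (auto simp: card_2_iff)
  then have "1 \<le> x" "x \<le> n" "1 \<le> y" "y \<le> n" using e by auto
  then show ?thesis using xy by (intro that[of "x - 1" "y - 1"]) (auto simp: vertex_edge_def)
qed

lemma card_all_edges_le: "real (card (all_edges n)) \<le> (real n)\<^sup>2"
proof -
  have "all_edges n \<subseteq> case_prod vertex_edge ` ({..<n} \<times> {..<n})"
    by (auto elim!: all_edges_cases)
  then have "card (all_edges n) \<le> card ({..<n} \<times> {..<n})"
    by (meson card_image_le card_mono finite_SigmaI finite_imageI finite_lessThan order_trans)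
  then show ?thesis by (simp add: power2_eq_square card_cartesian_product flip: of_nat_mult)
qed

lemma adj_flip:
  assumes "i \<noteq> j"
  shows "adj (X(vertex_edge i j := True)) k l - adj (X(vertex_edge i j := False)) k l =
    of_bool (k = i) * of_bool (l = j) + of_bool (k = j) * of_bool (l = i)"
  using assms by (auto simp: adj_def centred_def vertex_edge_eq_iff)

lemma deg_flip:
  assumes "i < n" "j < n" "i \<noteq> j"
  shows "deg (X(vertex_edge i j := True)) k - deg (X(vertex_edge i j := False)) k = of_bool (k = i) + of_bool (k = j)"
  unfolding deg_def sum_subtractf[symmetric] adj_flip[OF assms(3)] sum.distrib
  by (subst (1 2) sum_mult_of_bool_eq_single(2)) (use assms in auto)

text \<open>Each of the three terms contributes 2. The flip changes \<open>adj\<close> by a matrix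
  with nonzero eigenvalues 1 and -1, \<open>lap\<close> by a rank-one matrix with eigenvalue 2, and
  the total degree by 2.\<close>

lemma gap_flip:
  assumes "e \<in> all_edges n"
  shows "\<bar>gap (X(e := True)) - gap (X(e := False))\<bar> \<le> 6"
proof -
  obtain i j where ij: "i < n" "j < n" "i \<noteq> j" and e: "e = vertex_edge i j"
    using all_edges_cases[OF assms] by blast
  let ?T = "X(e := True)" and ?F = "X(e := False)"
  have "\<bar>array_trace_norm n (adj ?T) - array_trace_norm n (adj ?F)\<bar> \<le> 2"
  proof (rule trace_norm_diff_le)
    fix w assume w: "form_contraction n w"
    have "(\<Sum>k<n. \<Sum>l<n. w k l * (adj ?T k l - adj ?F k l)) = w i j + w j i"
      unfolding e adj_flip[OF ij(3)] distrib_left sum.distrib using ij by (simp only: sum_mult_pick)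
    then show "\<bar>\<Sum>k<n. \<Sum>l<n. w k l * (adj ?T k l - adj ?F k l)\<bar> \<le> 2"
      using form_contraction_bounds(1)[OF w ij(1,2)] form_contraction_bounds(1)[OF w ij(2,1)] by linarith
  qed (rule adj_sym)+
  moreover have "\<bar>array_trace_norm n (lap ?T) - array_trace_norm n (lap ?F)\<bar> \<le> 2"
  proof (rule trace_norm_diff_le)
    fix w assume w: "form_contraction n w"
    have lap_flip: "lap ?T k l - lap ?F k l = of_bool (k = i) * of_bool (l = i) + of_bool (k = j) * of_bool (l = j)
        - of_bool (k = i) * of_bool (l = j) - of_bool (k = j) * of_bool (l = i)" for k l
    proof -
      have lap_flip: "lap ?T k l - lap ?F k l = of_bool (k = l) * (deg ?T k - deg ?F k) - (adj ?T k l - adj ?F k l)"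
        by (simp add: lap_def algebra_simps)
      then show ?thesis unfolding e deg_flip[OF ij] adj_flip[OF ij(3)] by auto
    qed
    have "(\<Sum>k<n. \<Sum>l<n. w k l * (lap ?T k l - lap ?F k l)) = w i i + w j j - w i j - w j i"
      unfolding lap_flip right_diff_distrib distrib_left sum.distrib sum_subtractf
      using ij by (simp only: sum_mult_pick right_diff_distrib distrib_left sum.distrib sum_subtractf)
    then show "\<bar>\<Sum>k<n. \<Sum>l<n. w k l * (lap ?T k l - lap ?F k l)\<bar> \<le> 2"
      using form_contraction_bounds(3)[OF w ij] by simp
  qed (rule lap_sym)+
  moreover have "total_deg ?T - total_deg ?F = 2"
  proof -
    have "total_deg ?T - total_deg ?F = (\<Sum>k<n. 1 * of_bool (k = i) + 1 * of_bool (k = j))"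
      unfolding total_deg_def sum_subtractf[symmetric] e deg_flip[OF ij] by simp
    also have "\<dots> = 2" unfolding sum.distrib using ij by (simp only: sum_mult_of_bool_eq_single)
    finally show ?thesis .
  qed
  ultimately show ?thesis unfolding gap_def by linarith
qed

section \<open>Passing between the energies and the centred matrices\<close>

definition edge_set :: "(nat set \<Rightarrow> bool) \<Rightarrow> nat set set" where
  "edge_set X = {e \<in> all_edges n. X e}"

lemma adjacency_entry:
  assumes "i < n" "j < n"
  shows "(if {Suc i, Suc j} \<in> edge_set X then 1 else 0) = adj X i j + p * of_bool (i \<noteq> j)"
proof (cases "i = j")
  case True
  then show ?thesis by (auto simp: edge_set_def all_edges_def)
next
  case False
  then have "vertex_edge i j \<in> all_edges n" using assms by (intro vertex_edge_in)
  then show ?thesis using False by (auto simp: adj_def centred_def edge_set_def vertex_edge_def)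
qed

text \<open>The mean of the adjacency matrix is \<open>p\<close> times the all-ones matrix minus the
  identity. Pairing a contraction with either of these two matrices gives at most \<open>n\<close>
  in absolute value.\<close>

lemma form_contraction_off_diag:
  assumes w: "form_contraction n w"
  shows "\<bar>\<Sum>i<n. \<Sum>j<n. w i j * (c * of_bool (i = j))\<bar> \<le> \<bar>c\<bar> * real n"
    and "\<bar>\<Sum>i<n. \<Sum>j<n. w i j * (p * of_bool (i \<noteq> j))\<bar> \<le> 2 * real n"
proof -
  have diag: "(\<Sum>i<n. \<Sum>j<n. w i j * (c * of_bool (i = j))) = c * (\<Sum>i<n. w i i)" for c
  proof -
    have "(\<Sum>i<n. \<Sum>j<n. w i j * (c * of_bool (i = j))) = (\<Sum>i<n. \<Sum>j<n. (w i j * c) * of_bool (i = j))"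
      by (simp only: mult.assoc)
    also have "\<dots> = (\<Sum>i<n. w i i * c)"
      by (rule sum.cong[OF refl], rule sum_mult_of_bool_eq_single(1)) simp
    finally show ?thesis by (simp add: sum_distrib_left mult.commute)
  qed
  have "\<bar>\<Sum>i<n. w i i\<bar> \<le> (\<Sum>i<n. \<bar>w i i\<bar>)" by (rule sum_abs)
  also have "\<dots> \<le> (\<Sum>i<n. 1)" by (intro sum_mono form_contraction_bounds(1)[OF w]) auto
  finally have tr: "\<bar>\<Sum>i<n. w i i\<bar> \<le> real n" by simp
  show "\<bar>\<Sum>i<n. \<Sum>j<n. w i j * (c * of_bool (i = j))\<bar> \<le> \<bar>c\<bar> * real n"
    unfolding diag abs_mult by (intro mult_left_mono tr) simp
  have "(\<Sum>i<n. \<Sum>j<n. w i j * (p * of_bool (i \<noteq> j))) =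
      (\<Sum>i<n. \<Sum>j<n. p * w i j) - (\<Sum>i<n. \<Sum>j<n. w i j * (p * of_bool (i = j)))"
    unfolding sum_subtractf[symmetric] by (intro sum.cong refl) auto
  also have "\<dots> = p * ((\<Sum>i<n. \<Sum>j<n. w i j) - (\<Sum>i<n. w i i))"
    unfolding diag by (simp add: right_diff_distrib sum_distrib_left)
  finally have "\<bar>\<Sum>i<n. \<Sum>j<n. w i j * (p * of_bool (i \<noteq> j))\<bar> =
      p * \<bar>(\<Sum>i<n. \<Sum>j<n. w i j) - (\<Sum>i<n. w i i)\<bar>"
    using p01 by (simp add: abs_mult)
  also have "\<dots> \<le> 1 * (2 * real n)"
    using p01 form_contraction_bounds(2)[OF w] tr by (intro mult_mono) auto
  finally show "\<bar>\<Sum>i<n. \<Sum>j<n. w i j * (p * of_bool (i \<noteq> j))\<bar> \<le> 2 * real n" by simp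
qed

lemma graph_energy_le: "graph_energy n (edge_set X) \<le> array_trace_norm n (adj X) + 2 * real n"
proof -
  define b where "b i j = adj X i j + p * of_bool (i \<noteq> j)" for i j
  have "adjacency_matrix n (edge_set X) = mat n n (\<lambda>(i, j). b i j)"
    unfolding adjacency_matrix_def b_def by (intro eq_matI) (auto simp: adjacency_entry)
  then have "graph_energy n (edge_set X) = array_trace_norm n b"
    by (simp add: graph_energy_def trace_norm_def)
  also have "\<dots> \<le> array_trace_norm n (adj X) + 2 * real n"
  proof (rule trace_norm_perturb)
    show "b i j = b j i" for i j unfolding b_def using adj_sym[of X i j] by auto
    fix w assume "form_contraction n w"
    then show "(\<Sum>i<n. \<Sum>j<n. w i j * (b i j - adj X i j)) \<le> 2 * real n"
      using form_contraction_off_diag(2)[of w] unfolding b_def by (simp add: abs_le_iff)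
  qed (rule adj_sym)
  finally show ?thesis .
qed

lemma degree_in_eq:
  assumes "i < n"
  shows "real (degree_in n (edge_set X) (Suc i)) = deg X i + p * (real n - 1)"
proof -
  have "{u \<in> {1..n}. {u, Suc i} \<in> edge_set X} = Suc ` {j \<in> {..<n}. {Suc i, Suc j} \<in> edge_set X}"
  proof (intro equalityI subsetI)
    fix u assume "u \<in> {u \<in> {1..n}. {u, Suc i} \<in> edge_set X}"
    then show "u \<in> Suc ` {j \<in> {..<n}. {Suc i, Suc j} \<in> edge_set X}"
      by (intro image_eqI[of _ _ "u - 1"]) (auto simp: insert_commute)
  qed (auto simp: insert_commute)
  then have "real (degree_in n (edge_set X) (Suc i)) = real (card {j \<in> {..<n}. {Suc i, Suc j} \<in> edge_set X})"
    unfolding degree_in_def by (simp add: card_image)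
  also have "\<dots> = (\<Sum>j<n. if {Suc i, Suc j} \<in> edge_set X then 1 else 0)"
    by (simp add: sum.If_cases Int_def)
  also have "\<dots> = (\<Sum>j<n. adj X i j + (p - p * of_bool (i = j)))"
    by (intro sum.cong refl) (use assms in \<open>auto simp: adjacency_entry\<close>)
  also have "\<dots> = deg X i + p * (real n - 1)"
    unfolding sum.distrib sum_subtractf sum_mult_of_bool_eq_single(1)[OF assms]
    by (simp add: deg_def algebra_simps)
  finally show ?thesis .
qed

text \<open>The deterministic part \<open>p * (n - 1)\<close> of the degrees cancels against the
  average degree. What remains is the scalar matrix of \<open>c\<close>, costing the absolute total
  degree, and the off-diagonal mean, costing \<open>2 * n\<close>.\<close>

lemma laplacian_energy_ge:
  assumes n: "n > 0"
  shows "array_trace_norm n (lap X) \<le> laplacian_energy n (edge_set X) + \<bar>total_deg X\<bar> + 2 * real n"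
proof -
  define c where "c = total_deg X / real n"
  define b where "b i j = lap X i j - c * of_bool (i = j) - p * of_bool (i \<noteq> j)" for i j
  have "(\<Sum>v = 1..n. real (degree_in n (edge_set X) v)) = (\<Sum>i<n. real (degree_in n (edge_set X) (Suc i)))"
    by (rule sum.reindex_bij_witness[of _ Suc "\<lambda>v. v - 1"]) auto
  also have "\<dots> = total_deg X + real n * (p * (real n - 1))"
    by (simp add: degree_in_eq total_deg_def sum.distrib)
  finally have avg: "1 / real n * (\<Sum>v = 1..n. real (degree_in n (edge_set X) v)) = c + p * (real n - 1)"
    using n by (simp add: c_def field_simps)
  have "centred_laplacian_matrix n (edge_set X) = mat n n (\<lambda>(i, j). b i j)"
    unfolding centred_laplacian_matrix_def laplacian_matrix_def avg adjacency_matrix_def degree_matrix_def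
    by (intro eq_matI) (auto simp: adjacency_entry degree_in_eq b_def lap_def)
  then have le: "laplacian_energy n (edge_set X) = array_trace_norm n b"
    by (simp add: laplacian_energy_def trace_norm_def)
  have "array_trace_norm n (lap X) \<le> array_trace_norm n b + (\<bar>total_deg X\<bar> + 2 * real n)"
  proof (rule trace_norm_perturb)
    show "b i j = b j i" for i j unfolding b_def using lap_sym[of X i j] by auto
    fix w assume w: "form_contraction n w"
    have "(\<Sum>i<n. \<Sum>j<n. w i j * (lap X i j - b i j)) =
       (\<Sum>i<n. \<Sum>j<n. w i j * (c * of_bool (i = j))) + (\<Sum>i<n. \<Sum>j<n. w i j * (p * of_bool (i \<noteq> j)))"
      unfolding b_def sum.distrib[symmetric] by (intro sum.cong refl) (simp add: algebra_simps)
    also have "\<dots> \<le> \<bar>c\<bar> * real n + 2 * real n"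
      using form_contraction_off_diag(1)[OF w, of c] form_contraction_off_diag(2)[OF w] by linarith
    also have "\<bar>c\<bar> * real n = \<bar>total_deg X\<bar>" using n by (simp add: c_def)
    finally show "(\<Sum>i<n. \<Sum>j<n. w i j * (lap X i j - b i j)) \<le> \<bar>total_deg X\<bar> + 2 * real n" .
  qed (rule lap_sym)
  then show ?thesis unfolding le by simp
qed

text \<open>The two comparisons lose \<open>2 * n\<close> each, so a gap above \<open>4 * n\<close>
  forces the strict inequality. The bad event is controlled with bounded differences 6 and at most
  \<open>n^2\<close> edges.\<close>

lemma prob_energy_less_ge:
  assumes n: "n > 0" and m: "4 * real n < m" "m \<le> expec gap"
  shows "measure_pmf.prob (erdos_renyi n p) {E. graph_energy n E < laplacian_energy n E}
    \<ge> 1 - 36 * (real n)\<^sup>2 / (m - 4 * real n)\<^sup>2"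
proof -
  have "{X. gap X \<le> 4 * real n} \<union> edge_set -` {E. graph_energy n E < laplacian_energy n E} = UNIV"
  proof -
    have "graph_energy n (edge_set X) < laplacian_energy n (edge_set X)" if "\<not> gap X \<le> 4 * real n" for X
      using that graph_energy_le[of X] laplacian_energy_ge[OF n, of X] unfolding gap_def by linarith
    then show ?thesis by auto
  qed
  then have "1 \<le> measure_pmf.prob product_pmf {X. gap X \<le> 4 * real n} +
      measure_pmf.prob product_pmf (edge_set -` {E. graph_energy n E < laplacian_energy n E})"
    using measure_Un_le[of "{X. gap X \<le> 4 * real n}" "measure_pmf product_pmf"
      "edge_set -` {E. graph_energy n E < laplacian_energy n E}"] by simp
  moreover have "erdos_renyi n p = map_pmf edge_set product_pmf"
    unfolding erdos_renyi_def product_pmf_def edge_set_def ..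
  moreover have "measure_pmf.prob product_pmf {X. gap X \<le> 4 * real n} \<le> 36 * (real n)\<^sup>2 / (m - 4 * real n)\<^sup>2"
  proof -
    have "measure_pmf.prob product_pmf {X. gap X \<le> 4 * real n} \<le> 6\<^sup>2 * real (card (all_edges n)) / (expec gap - 4 * real n)\<^sup>2"
      using m by (intro prob_le_bounded_differences gap_flip) auto
    also have "\<dots> \<le> 36 * (real n)\<^sup>2 / (m - 4 * real n)\<^sup>2"
      using m card_all_edges_le by (intro frac_le power_mono) auto
    finally show ?thesis .
  qed
  ultimately show ?thesis by simp
qed

end

theorem theorem5:
  fixes p :: real
  assumes "0 < p" and "p < 1"
  shows "(\<lambda>n. measure_pmf.prob (erdos_renyi n p) {E. graph_energy n E < laplacian_energy n E})
           \<longlonglongrightarrow> 1"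
proof -
  define c where "c = p * (1 - p)"
  have c: "c > 0" using assms by (simp add: c_def)
  \<comment> \<open>The lower bound for the mean gap, of order \<open>n\<close> to the power 3/2, so
    it eventually exceeds \<open>4 * n\<close>.\<close>
  define m :: "nat \<Rightarrow> real" where "m n = 5 / 176 * (real n * sqrt (c * real n)) - 3 / 2 * sqrt (c * real n)
    - 3 * ((real n)\<^sup>2 / sqrt (c * real n) ^ 3) - real n ^ 3 / sqrt (c * real n) ^ 5 - 2 * real n" for n
  have "eventually (\<lambda>n. 4 * real n < m n) sequentially"
    unfolding m_def using c by real_asymp
  then have lower: "eventually (\<lambda>n. 1 - 36 * (real n)\<^sup>2 / (m n - 4 * real n)\<^sup>2 \<le>
      measure_pmf.prob (erdos_renyi n p) {E. graph_energy n E < laplacian_energy n E}) sequentially"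
    using eventually_gt_at_top[of 0]
  proof eventually_elim
    case (elim n)
    interpret random_graph n p by unfold_locales (use assms in auto)
    have "m n \<le> expec gap"
      using expec_gap_ge[OF elim(2)] unfolding m_def sigma2_def c_def .
    then show ?case by (rule prob_energy_less_ge[OF elim(2,1)])
  qed
  \<comment> \<open>The denominator has order \<open>n^3\<close>, so the failure probability is
    \<open>O(1 / n)\<close>.\<close>
  have "(\<lambda>n. 1 - 36 * (real n)\<^sup>2 / (m n - 4 * real n)\<^sup>2) \<longlonglongrightarrow> 1"
    unfolding m_def using c by real_asymp
  then show ?thesis
    by (rule tendsto_sandwich[OF lower _ _ tendsto_const, rotated]) simp
qed

end
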